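(* For $0<t<1$ and $0\le\lambda<1$ let $$\sigma_{t,\lambda}=\frac{|0\rangle\langle0|+t^2|3\rangle\langle3|+\lambda t\,(|0\rangle\langle3|+|3\rangle\langle0|)}{1+t^2},$$ let $F(x)=-1+6x-6x^2+\frac43x^3$, and set $$\lambda_{\rm pos}(t)=\min_{x>0}\frac{\sqrt3\,[1+t^2F(x)]}{4t\,x^{3/2}}.$$ Then: (i) the minimum defining $\lambda_{\rm pos}(t)$ is attained, at the unique positive root $x$ of $t^2(4x^3-6x^2-6x+3)=3$, and $W_{\sigma_{t,\lambda}}\ge0$ everywhere on $\mathbb R^2$ if and only if $\lambda\le\lambda_{\rm pos}(t)$; (ii) for fixed $t$, the map $\lambda\mapsto h(W_{\sigma_{t,\lambda}})$ is strictly decreasing on $0\le\lambda<\lambda_{\rm pos}(t)$; consequently, if $h(W_{\sigma_{t,\lambda}})-(1+\ln\pi)$ takes both signs on this interval, it has a unique zero there; (iii) for $0\le\lambda<\lambda_{\rm pos}(t)$, $$\frac{h(W_{\sigma_{t,\lambda}})-(1+\ln\pi)}{t^2}\le\frac{6-8\lambda^2+(-110+488\lambda^2)t^2+(86348/3)t^4}{(1+t^2)^3}.$$ Let $T$ denote the set of amplitudes $t$ displayed in the source's plotted $(t,\lambda)$ parameter map, all of which satisfy $8-488t^2>0$. For $t\in T$, requiring the numerator on the right to be negative gives the sufficient condition: if $$\left[\frac{6-110t^2+(86348/3)t^4}{8-488t^2}\right]^{1/2}<\lambda<\lambda_{\rm pos}(t),$$ then $h(W_{\sigma_{t,\lamb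da}})<1+\ln\pi$.
   Context: One bosonic mode on $L^2(\mathbb R)$ with $[\hat q,\hat p]=i$, $\hat a=(\hat q+i\hat p)/\sqrt2$; $|n\rangle$ are the Fock (number) states, $|n\rangle=(\hat a^\dagger)^n|0\rangle/\sqrt{n!}$ with $\hat a|0\rangle=0$. The Wigner function of a density operator is $W_\rho(q,p)=\frac1\pi\int_{\mathbb R}e^{2ipy}\langle q-y|\rho|q+y\rangle\,dy$. For $W_\rho\ge0$, $h(W_\rho)=-\int_{\mathbb R^2}W_\rho\ln W_\rho\,dq\,dp$ (natural logarithm); the vacuum has $h=1+\ln\pi$. The set $T$ in (iii) is a range of amplitudes shown in a figure of the source, which includes $t=0.005$; its endpoints are not stated in the source's text, and the only property of it used in deriving the sufficient condition from the displayed inequality is $8-488t^2>0$. *)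

theory Defs
  imports "HOL-Probability.Probability"
begin

text \<open>
  States of one mode are wave functions in the position representation, and an operator on
  \<open>L\<^sup>2(\<real>)\<close> is given by its position kernel \<open>K x y = \<langle>x|K|y\<rangle>\<close>; all operators used here have finite
  rank, with smooth kernels.
\<close>

type_synonym wavefun = "real \<Rightarrow> complex"
type_synonym kernel = "real \<Rightarrow> real \<Rightarrow> complex"

definition position_op :: "wavefun \<Rightarrow> wavefun" where
  "position_op f = (\<lambda>x. of_real x * f x)"

definition momentum_op :: "wavefun \<Rightarrow> wavefun" where
  "momentum_op f = (\<lambda>x. - \<i> * vector_derivative f (at x))"

definition annihilation :: "wavefun \<Rightarrow> wavefun" where
  "annihilation f = (\<lambda>x. (position_op f x + \<i> * momentum_op f x) / of_real (sqrt 2))"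

definition creation :: "wavefun \<Rightarrow> wavefun" where
  "creation f = (\<lambda>x. (position_op f x - \<i> * momentum_op f x) / of_real (sqrt 2))"

text \<open>
  The normalised solution of \<open>annihilation f = 0\<close>. It is unique up to a constant phase (see
  \<open>annihilation_eq_0_imp\<close>), which cancels in every \<open>ketbra (fock m) (fock n)\<close>.
\<close>

definition vacuum :: wavefun where
  "vacuum = (\<lambda>x. of_real (pi powr (- 1 / 4) * exp (- x\<^sup>2 / 2)))"

definition fock :: "nat \<Rightarrow> wavefun" where
  "fock n = (\<lambda>x. (creation ^^ n) vacuum x / of_real (sqrt (fact n)))"

definition ketbra :: "wavefun \<Rightarrow> wavefun \<Rightarrow> kernel" where
  "ketbra f g = (\<lambda>x y. f x * cnj (g y))"

text \<open>
  For Hermitian kernels the integral is real (see \<open>wigner_integral_real\<close>), so taking the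
  real part only changes the type.
\<close>

definition wigner :: "kernel \<Rightarrow> real \<times> real \<Rightarrow> real" where
  "wigner K = (\<lambda>(q, p). Re (1 / of_real pi *
     (LINT y|lborel. exp (2 * \<i> * of_real p * of_real y) * K (q - y) (q + y))))"

text \<open>Differential entropy; at zeros of \<open>W\<close> the integrand is \<open>0\<close>, the usual convention.\<close>

definition wigner_entropy :: "(real \<times> real \<Rightarrow> real) \<Rightarrow> real" where
  "wigner_entropy W = - (LINT z|lborel. W z * ln (W z))"

definition sigma_state :: "real \<Rightarrow> real \<Rightarrow> kernel" where
  "sigma_state t l = (\<lambda>x y.
     (ketbra (fock 0) (fock 0) x y + of_real (t\<^sup>2) * ketbra (fock 3) (fock 3) x y
      + of_real (l * t) * (ketbra (fock 0) (fock 3) x y + ketbra (fock 3) (fock 0) x y))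
     / of_real (1 + t\<^sup>2))"

definition h_sigma :: "real \<Rightarrow> real \<Rightarrow> real" where
  "h_sigma t l = wigner_entropy (wigner (sigma_state t l))"

definition F_poly :: "real \<Rightarrow> real" where
  "F_poly x = - 1 + 6 * x - 6 * x\<^sup>2 + 4 / 3 * x ^ 3"

definition pos_bound :: "real \<Rightarrow> real \<Rightarrow> real" where
  "pos_bound t x = sqrt 3 * (1 + t\<^sup>2 * F_poly x) / (4 * t * x powr (3 / 2))"

text \<open>Written as an infimum; that it is a minimum is part of the main statement.\<close>

definition lambda_pos :: "real \<Rightarrow> real" where
  "lambda_pos t = (INF x\<in>{0<..}. pos_bound t x)"

lemma vacuum_has_vector_derivative:
  "(vacuum has_vector_derivative (- of_real x * vacuum x)) (at x)"
proof -
  have "((\<lambda>x. pi powr (- 1 / 4) * exp (- x\<^sup>2 / 2)) has_real_derivative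
      (- x * (pi powr (- 1 / 4) * exp (- x\<^sup>2 / 2)))) (at x)"
    by (auto intro!: derivative_eq_intros)
  then have "((\<lambda>x. complex_of_real (pi powr (- 1 / 4) * exp (- x\<^sup>2 / 2))) has_vector_derivative
      of_real (- x * (pi powr (- 1 / 4) * exp (- x\<^sup>2 / 2)))) (at x)"
    by (intro has_vector_derivative_of_real)
       (simp add: has_real_derivative_iff_has_vector_derivative)
  then show ?thesis
    by (simp add: vacuum_def)
qed

lemma annihilation_vacuum: "annihilation vacuum = (\<lambda>x. 0)"
  by (simp add: fun_eq_iff annihilation_def position_op_def momentum_op_def
      vector_derivative_at[OF vacuum_has_vector_derivative])

lemma vacuum_normalised: "(LINT x|lborel. (cmod (vacuum x))\<^sup>2) = 1"
proof -
  have "(cmod (vacuum x))\<^sup>2 = normal_density 0 (sqrt (1 / 2)) x" for x :: real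
  proof -
    have "(pi powr (- 1 / 4))\<^sup>2 = pi powr (- 1 / 2)"
      by (simp add: powr_powr flip: powr_realpow)
    also have "\<dots> = 1 / sqrt pi"
      by (simp add: powr_minus_divide powr_half_sqrt)
    finally have 1: "(pi powr (- 1 / 4))\<^sup>2 = 1 / sqrt pi" .
    have 2: "(exp (- x\<^sup>2 / 2))\<^sup>2 = exp (- x\<^sup>2)"
      by (simp flip: exp_double)
    have "cmod (vacuum x) = pi powr (- 1 / 4) * exp (- x\<^sup>2 / 2)"
      unfolding vacuum_def by (simp only: norm_of_real) simp
    then show ?thesis
      using 1 2 by (simp add: normal_density_def power_mult_distrib)
  qed
  then show ?thesis
    using integral_normal_density[of "sqrt (1 / 2)" 0] by simp
qed

lemma annihilation_eq_0_imp:
  fixes f :: wavefun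
  assumes diff: "\<And>x. f differentiable (at x)" and ann: "annihilation f = (\<lambda>x. 0)"
  shows "\<exists>c. f = (\<lambda>x. c * vacuum x)"
proof -
  define E :: wavefun where "E = (\<lambda>x. of_real (exp (x\<^sup>2 / 2)))"
  have E': "(E has_vector_derivative (of_real x * E x)) (at x)" for x
  proof -
    have "((\<lambda>x. exp (x\<^sup>2 / 2)) has_real_derivative (x * exp (x\<^sup>2 / 2))) (at x)"
      by (auto intro!: derivative_eq_intros)
    then have "((\<lambda>x. complex_of_real (exp (x\<^sup>2 / 2))) has_vector_derivative
        of_real (x * exp (x\<^sup>2 / 2))) (at x)"
      by (intro has_vector_derivative_of_real)
         (simp add: has_real_derivative_iff_has_vector_derivative)
    then show ?thesis
      by (simp add: E_def)
  qed
  have f': "(f has_vector_derivative (- of_real x * f x)) (at x)" for x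
  proof -
    have "annihilation f x = 0"
      using ann by simp
    then have "vector_derivative f (at x) = - of_real x * f x"
      by (simp add: annihilation_def position_op_def momentum_op_def add_eq_0_iff)
    then show ?thesis
      using diff[of x] vector_derivative_works by metis
  qed
  have "((\<lambda>x. f x * E x) has_vector_derivative 0) (at x within UNIV)" for x
    using has_vector_derivative_mult[OF f' E', of x] by (simp add: algebra_simps)
  then obtain c where c: "f x * E x = c" for x
    using has_vector_derivative_zero_constant[of UNIV "\<lambda>x. f x * E x"] by auto
  have "f x = c * of_real (pi powr (1 / 4)) * vacuum x" for x
  proof -
    have a: "pi powr (1 / 4) * pi powr (- 1 / 4) = 1"
      by (simp flip: powr_add)
    have b: "exp (x\<^sup>2 / 2) * exp (- x\<^sup>2 / 2) = (1 :: real)"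
      by (simp flip: exp_add)
    have "c * of_real (pi powr (1 / 4)) * vacuum x
        = f x * of_real ((pi powr (1 / 4) * pi powr (- 1 / 4)) * (exp (x\<^sup>2 / 2) * exp (- x\<^sup>2 / 2)))"
      unfolding c[of x, symmetric] E_def vacuum_def by (simp only: of_real_mult mult_ac)
    then show ?thesis
      by (simp only: a b) simp
  qed
  then show ?thesis
    by blast
qed

lemma wigner_integral_real:
  assumes "\<And>x y. K y x = cnj (K x y)"
  shows "1 / of_real pi * (LINT y|lborel. exp (2 * \<i> * of_real p * of_real y) * K (q - y) (q + y))
    = of_real (wigner K (q, p))"
proof -
  define I where "I = (LINT y|lborel. exp (2 * \<i> * of_real p * of_real y) * K (q - y) (q + y))"
  have "cnj I = (LINT y|lborel. cnj (exp (2 * \<i> * of_real p * of_real y) * K (q - y) (q + y)))"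
    unfolding I_def by (rule Bochner_Integration.integral_cnj[symmetric])
  also have "\<dots> = (LINT y|lborel. exp (2 * \<i> * of_real p * of_real (- y)) * K (q - - y) (q + - y))"
    by (intro Bochner_Integration.integral_cong refl)
       (simp add: assms[of "q + _" "q - _"] exp_cnj)
  also have "\<dots> = I"
    unfolding I_def
    using lborel_integral_real_affine[of "-1"
        "\<lambda>y. exp (2 * \<i> * of_real p * of_real y) * K (q - y) (q + y)" 0] by simp
  finally have "Im (1 / of_real pi * I) = 0"
    by (auto simp: complex_eq_iff)
  then show ?thesis
    by (simp add: wigner_def I_def[symmetric] complex_eq_iff)
qed

lemma sigma_hermitian: "sigma_state t l y x = cnj (sigma_state t l x y)"
  by (simp add: sigma_state_def ketbra_def algebra_simps)

end

theory Submission
  imports Defs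
begin

text \<open>
  Write \<open>r\<^sup>2 = q\<^sup>2 + p\<^sup>2\<close>. Integrating the Gaussian moments by parts gives
  \<open>W = G \<cdot> g\<close> with the vacuum density \<open>G = exp (- r\<^sup>2) / \<pi>\<close> and
  \<open>g = (1 + t\<^sup>2 F(r\<^sup>2) + \<lambda> t H) / (1 + t\<^sup>2)\<close>, where \<open>H = 4 (q\<^sup>3 - 3 q p\<^sup>2) / \<surd>3\<close> has extreme values
  \<open>\<plusminus> 4 r\<^sup>3 / \<surd>3\<close> on the circle of radius \<open>r\<close>; this yields the positivity threshold. With \<open>E\<close> the mean
  under \<open>G\<close>, \<open>h = 1 + ln \<pi> + 6 t\<^sup>2 / (1 + t\<^sup>2) - E[g ln g]\<close>. The last mean is strictly convex in \<open>\<lambda>\<close> and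
  even, because \<open>H\<close> is odd; hence it is continuous and strictly increasing on \<open>\<lambda> \<ge> 0\<close>. Finally
  \<open>(1 + e) ln (1 + e) \<ge> e + e\<^sup>2 / 2 - e\<^sup>3 / 6\<close> reduces the upper bound on \<open>h\<close> to polynomial moments of
  \<open>e = g - 1\<close> under \<open>G\<close>.
\<close>

section \<open>The Wigner function\<close>

text \<open>Creation is (x - d/dx) / sqrt 2, and the vacuum has derivative -x times itself. Hence
  creation acts on the prefactor \<open>u\<close> alone, by the recursion of the Hermite polynomials
  up to normalisation.\<close>

lemma creation_mult_vacuum:
  assumes "\<And>x. (u has_real_derivative u' x) (at x)"
  shows "creation (\<lambda>x. of_real (u x) * vacuum x)
    = (\<lambda>x. of_real ((2 * x * u x - u' x) / sqrt 2) * vacuum x)"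
proof
  fix x
  have "((\<lambda>x. complex_of_real (u x)) has_vector_derivative of_real (u' x)) (at x)"
    using assms by (intro has_vector_derivative_of_real)
      (simp add: has_real_derivative_iff_has_vector_derivative)
  from has_vector_derivative_mult[OF this vacuum_has_vector_derivative]
  have "vector_derivative (\<lambda>x. of_real (u x) * vacuum x) (at x)
      = of_real (u x) * (- of_real x * vacuum x) + of_real (u' x) * vacuum x"
    by (rule vector_derivative_at)
  then show "creation (\<lambda>x. of_real (u x) * vacuum x) x
      = of_real ((2 * x * u x - u' x) / sqrt 2) * vacuum x"
    by (simp add: creation_def position_op_def momentum_op_def field_simps)
qed

lemma fock_0: "fock 0 = vacuum"
  by (simp add: fock_def fun_eq_iff)

text \<open>Three rounds of the recursion starting from the prefactor 1; the result is the Hermite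
  polynomial 8 x^3 - 12 x divided by sqrt (2^3 * 3!) = 4 sqrt 3.\<close>

lemma fock_3: "fock 3 = (\<lambda>x. of_real ((2 * x ^ 3 - 3 * x) / sqrt 3) * vacuum x)"
proof
  fix x :: real
  have 1: "creation vacuum = (\<lambda>x. of_real (sqrt 2 * x) * vacuum x)"
  proof -
    have "creation (\<lambda>x. of_real 1 * vacuum x)
        = (\<lambda>x. of_real ((2 * x * 1 - 0) / sqrt 2) * vacuum x)"
      by (rule creation_mult_vacuum) (auto intro!: derivative_eq_intros)
    moreover have "2 * x / sqrt 2 = sqrt 2 * x" for x :: real
      by (simp add: field_simps flip: power2_eq_square)
    ultimately show ?thesis by simp
  qed
  have 2: "creation (\<lambda>x. of_real (sqrt 2 * x) * vacuum x)
      = (\<lambda>x. of_real (2 * x\<^sup>2 - 1) * vacuum x)"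
  proof -
    have "(2 * x * (sqrt 2 * x) - sqrt 2) / sqrt 2 = 2 * x\<^sup>2 - 1" for x :: real
      by (simp add: field_simps power2_eq_square)
    then show ?thesis
      by (subst creation_mult_vacuum[where u' = "\<lambda>x. sqrt 2"]) (auto intro!: derivative_eq_intros)
  qed
  have 3: "creation (\<lambda>x. of_real (2 * x\<^sup>2 - 1) * vacuum x)
      = (\<lambda>x. of_real ((4 * x ^ 3 - 6 * x) / sqrt 2) * vacuum x)"
  proof -
    have "2 * x * (2 * x\<^sup>2 - 1) - 4 * x = 4 * x ^ 3 - 6 * x" for x :: real
      by (simp add: algebra_simps power2_eq_square power3_eq_cube)
    then show ?thesis
      by (subst creation_mult_vacuum[where u' = "\<lambda>x. 4 * x"])
        (auto intro!: derivative_eq_intros simp del: of_real_diff of_real_mult of_real_divide)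
  qed
  have "sqrt 2 * sqrt 6 = 2 * sqrt 3"
    by (simp add: real_sqrt_mult[of 2 3, simplified] flip: mult.assoc)
  then have "(4 * x ^ 3 - 6 * x) / sqrt 2 / sqrt 6 = (2 * (2 * x ^ 3 - 3 * x)) / (2 * sqrt 3)"
    by (simp only: divide_divide_eq_left) (simp add: algebra_simps)
  also have "\<dots> = (2 * x ^ 3 - 3 * x) / sqrt 3"
    by (rule mult_divide_mult_cancel_left) simp
  finally have "(4 * x ^ 3 - 6 * x) / sqrt 2 / sqrt 6 = (2 * x ^ 3 - 3 * x) / sqrt 3" .
  moreover have "fock 3 x = of_real ((4 * x ^ 3 - 6 * x) / sqrt 2 / sqrt 6) * vacuum x"
  proof -
    have "(creation ^^ 3) vacuum = creation (creation (creation vacuum))"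
      by (simp add: numeral_3_eq_3)
    also have "\<dots> = (\<lambda>x. of_real ((4 * x ^ 3 - 6 * x) / sqrt 2) * vacuum x)"
      by (simp only: 1 2 3)
    finally have "(creation ^^ 3) vacuum = (\<lambda>x. of_real ((4 * x ^ 3 - 6 * x) / sqrt 2) * vacuum x)" .
    moreover have "fact 3 = (6 :: real)"
      by (simp add: fact_numeral)
    ultimately show ?thesis
      unfolding fock_def by simp
  qed
  ultimately show "fock 3 x = of_real ((2 * x ^ 3 - 3 * x) / sqrt 3) * vacuum x"
    by (simp only:)
qed

section \<open>Fourier integrals of Gaussian moments\<close>

text \<open>Variance 1/2 gives the position density of the vacuum. The name refers to this variance;
  the density lives on the whole line.\<close>

abbreviation half_normal :: "real \<Rightarrow> real" where
  "half_normal \<equiv> normal_density 0 (sqrt (1 / 2))"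

text \<open>After its Gaussian factor is split off, the kernel of the state is a polynomial in y, so
  the Wigner transform reduces to these integrals.\<close>

definition normal_fourier :: "real \<Rightarrow> nat \<Rightarrow> complex" where
  "normal_fourier p k = (LINT y|lborel. of_real (half_normal y * y ^ k) * exp (2 * \<i> * of_real p * of_real y))"

lemma half_normal_eq: "half_normal y = exp (- y\<^sup>2) / sqrt pi"
  by (simp add: normal_density_def)

lemma integrable_normal_fourier:
  "integrable lborel (\<lambda>y. of_real (half_normal y * y ^ k) * exp (2 * \<i> * of_real p * of_real y))"
proof -
  have "integrable lborel (\<lambda>y. half_normal y * y ^ k)"
    using integrable_normal_moment[of "sqrt (1 / 2)" 0 k] by simp
  then show ?thesis
    by (rule Bochner_Integration.integrable_bound) (auto simp: norm_mult norm_power abs_mult power_abs intro!: AE_I2)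
qed

text \<open>Rescaling y by sqrt 2 turns the integral into the characteristic function of the
  standard normal law at sqrt 2 * p.\<close>

lemma normal_fourier_0: "normal_fourier p 0 = of_real (exp (- p\<^sup>2))"
proof -
  have s: "half_normal (y / sqrt 2) / sqrt 2 = std_normal_density y" for y
    by (simp add: normal_density_def power_divide real_sqrt_mult)
  have e: "2 * \<i> * of_real p * of_real (0 + 1 / sqrt 2 * y) = \<i> * of_real (sqrt 2 * p * y)" for y
  proof -
    have "2 * \<i> * of_real p * of_real (0 + 1 / sqrt 2 * y) = \<i> * of_real p * of_real (2 * (1 / sqrt 2 * y))"
      by simp
    also have "2 * (1 / sqrt 2 * y) = sqrt 2 * y"
      by (simp add: field_simps flip: power2_eq_square)
    finally show ?thesis
      by (simp add: mult_ac)
  qed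
  have "normal_fourier p 0
    = \<bar>1 / sqrt 2\<bar> *\<^sub>R (LINT y|lborel. of_real (half_normal (0 + 1 / sqrt 2 * y) * (0 + 1 / sqrt 2 * y) ^ 0)
        * exp (2 * \<i> * of_real p * of_real (0 + 1 / sqrt 2 * y)))"
    unfolding normal_fourier_def by (rule lborel_integral_real_affine) simp
  also have "\<dots> = (LINT y|lborel. of_real (half_normal (y / sqrt 2) / sqrt 2) * iexp (sqrt 2 * p * y))"
    unfolding e by (simp add: scaleR_conv_of_real field_simps flip: integral_mult_right_zero)
  also have "\<dots> = (LINT y|lborel. std_normal_density y *\<^sub>R iexp (sqrt 2 * p * y))"
    unfolding s by (simp add: scaleR_conv_of_real)
  also have "\<dots> = char std_normal_distribution (sqrt 2 * p)"
    unfolding char_def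
    by (subst integral_density) auto
  also have "\<dots> = of_real (exp (- p\<^sup>2))"
    by (simp add: char_std_normal_distribution power_mult_distrib)
  finally show ?thesis .
qed

lemma half_normal_power_tendsto_0:
  "((\<lambda>y. half_normal y * y ^ k) \<longlongrightarrow> 0) at_top" "((\<lambda>y. half_normal y * y ^ k) \<longlongrightarrow> 0) at_bot"
proof -
  show 1: "((\<lambda>y. half_normal y * y ^ k) \<longlongrightarrow> 0) at_top" for k
    unfolding half_normal_eq by real_asymp
  have "((\<lambda>y. (- 1) ^ k * (half_normal y * y ^ k)) \<longlongrightarrow> 0) at_top"
    using tendsto_mult_right_zero[OF 1] .
  moreover have "(- 1) ^ k * (half_normal y * y ^ k) = half_normal (- y) * (- y) ^ k" for y
    unfolding power_minus[of y k] by (simp add: normal_density_def)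
  ultimately show "((\<lambda>y. half_normal y * y ^ k) \<longlongrightarrow> 0) at_bot"
    by (intro filterlim_at_bot_mirror[THEN iffD2]) simp
qed

text \<open>The derivative of y^k exp (- y^2 + 2 i p y) integrates to zero over the line because the
  boundary terms vanish. For \<open>k = 0\<close> the truncated index \<open>k - 1\<close> is
  harmless, since its coefficient is 0.\<close>

lemma normal_fourier_rec:
  "normal_fourier p (Suc k) = \<i> * of_real p * normal_fourier p k + of_nat k / 2 * normal_fourier p (k - 1)"
proof -
  define e where "e = (\<lambda>y::real. exp (2 * \<i> * of_real p * of_real y))"
  define f where "f = (\<lambda>k y. complex_of_real (half_normal y * y ^ k) * e y)"
  define f' where "f' = (\<lambda>y. 2 * \<i> * of_real p * f k y + of_nat k * f (k - 1) y - 2 * f (Suc k) y)"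
  have int: "integrable lborel (f k)" for k
    unfolding f_def e_def by (rule integrable_normal_fourier)
  have M: "integral\<^sup>L lborel (f k) = normal_fourier p k" for k
    by (simp only: f_def e_def normal_fourier_def)
  have cont: "isCont (f k) y" for k y
    unfolding f_def e_def half_normal_eq by (intro continuous_intros) auto
  have lim: "((f k \<circ> real_of_ereal) \<longlongrightarrow> 0) (at_right (- \<infinity>))" "((f k \<circ> real_of_ereal) \<longlongrightarrow> 0) (at_left \<infinity>)"
  proof -
    have n: "norm (f k y) = norm (half_normal y * y ^ k)" for y
      by (simp add: f_def e_def norm_mult norm_power abs_mult power_abs)
    have "(f k \<longlongrightarrow> 0) at_bot" "(f k \<longlongrightarrow> 0) at_top"
      by (subst tendsto_norm_zero_iff[symmetric], unfold n,
          intro tendsto_norm_zero half_normal_power_tendsto_0)+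
    then show "((f k \<circ> real_of_ereal) \<longlongrightarrow> 0) (at_right (- \<infinity>))"
        "((f k \<circ> real_of_ereal) \<longlongrightarrow> 0) (at_left \<infinity>)"
      by (simp_all add: ereal_tendsto_simps1)
  qed
  have deriv: "(f k has_vector_derivative f' y) (at y)" for y
  proof -
    have "((\<lambda>y. half_normal y * y ^ k) has_real_derivative
        (of_nat k * (half_normal y * y ^ (k - 1)) - 2 * (half_normal y * y ^ Suc k))) (at y)"
    proof -
      have "((\<lambda>y. exp (- y\<^sup>2) / sqrt pi) has_real_derivative (- 2 * y * exp (- y\<^sup>2)) / sqrt pi) (at y)"
        by (rule DERIV_cdivide) (auto intro!: derivative_eq_intros)
      then have "(half_normal has_real_derivative (- 2 * y * half_normal y)) (at y)"
        by (simp add: half_normal_eq[abs_def])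
      from DERIV_mult[OF this DERIV_pow] show ?thesis
        by (rule DERIV_cong) (simp add: algebra_simps)
    qed
    then have "((\<lambda>y. complex_of_real (half_normal y * y ^ k)) has_vector_derivative
        of_real (of_nat k * (half_normal y * y ^ (k - 1)) - 2 * (half_normal y * y ^ Suc k))) (at y)"
      by (intro has_vector_derivative_of_real)
        (simp add: has_real_derivative_iff_has_vector_derivative)
    moreover have "(e has_vector_derivative (2 * \<i> * of_real p * e y)) (at y)"
      unfolding e_def
      by (rule has_vector_derivative_real_field) (auto intro!: derivative_eq_intros)
    ultimately show ?thesis
      unfolding f_def f'_def
      by (rule has_vector_derivative_eq_rhs[OF has_vector_derivative_mult]) (simp add: f_def algebra_simps)
  qed
  have "(LBINT y=-\<infinity>..\<infinity>. f' y) = 0 - 0"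
  proof (rule interval_integral_FTC_integrable)
    show "set_integrable lborel (einterval (- \<infinity>) \<infinity>) f'"
      unfolding f'_def by (simp add: set_integrable_def int)
    show "isCont f' y" for y
      unfolding f'_def by (intro continuous_intros cont)
  qed (use deriv lim in auto)
  then have "(LINT y|lborel. f' y) = 0"
    by (simp add: interval_lebesgue_integral_def set_lebesgue_integral_def)
  moreover have "(LINT y|lborel. f' y) = 2 * \<i> * of_real p * normal_fourier p k
      + of_nat k * normal_fourier p (k - 1) - 2 * normal_fourier p (Suc k)"
    unfolding f'_def by (simp add: int M)
  ultimately show ?thesis
    by (simp add: field_simps)
qed

section \<open>Closed form of the Wigner function\<close>

text \<open>This is 4 / sqrt 3 times the real part of (q + i p)^3, the contribution of the coherence
  between the Fock states 0 and 3.\<close>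

definition cubic_harmonic :: "real \<times> real \<Rightarrow> real" where
  "cubic_harmonic z = 4 / sqrt 3 * (fst z ^ 3 - 3 * fst z * (snd z)\<^sup>2)"

definition wigner_poly :: "real \<Rightarrow> real \<Rightarrow> real \<times> real \<Rightarrow> real" where
  "wigner_poly t l z =
     (1 + t\<^sup>2 * F_poly ((norm z)\<^sup>2) + l * t * cubic_harmonic z) / (1 + t\<^sup>2)"

text \<open>The Gaussian factors separate because (q - y)^2 + (q + y)^2 = 2 q^2 + 2 y^2. The
  remaining factor is symmetric under y -> -y, so only even powers of y survive;
  \<open>y ^ 0\<close> is kept so that every term matches the integrand of
  \<open>normal_fourier\<close>.\<close>

lemma sigma_state_eq:
  "sigma_state t l (q - y) (q + y) = of_real (exp (- q\<^sup>2) * (half_normal y *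
      (((1 + t\<^sup>2 / 3 * (4 * q ^ 6 - 12 * q ^ 4 + 9 * q\<^sup>2) + l * t / sqrt 3 * (4 * q ^ 3 - 6 * q)) * y ^ 0
      + (t\<^sup>2 / 3 * (- 12 * q ^ 4 - 9) + l * t / sqrt 3 * (12 * q)) * y ^ 2
      + t\<^sup>2 / 3 * (12 * q\<^sup>2 + 12) * y ^ 4 - t\<^sup>2 / 3 * 4 * y ^ 6) / (1 + t\<^sup>2))))"
proof -
  define h where "h = (\<lambda>x::real. 2 * x ^ 3 - 3 * x)"
  define v where "v = (\<lambda>x::real. pi powr (- 1 / 4) * exp (- x\<^sup>2 / 2))"
  have vac: "vacuum = (\<lambda>x. of_real (v x))"
    by (simp add: vacuum_def v_def)
  define g where "g = (\<lambda>x. h x / sqrt 3)"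
  have f3: "fock 3 = (\<lambda>x. of_real (g x * v x))"
    by (simp add: fock_3 vac g_def h_def)
  have vv: "v (q - y) * v (q + y) = exp (- q\<^sup>2) * half_normal y"
  proof -
    have "v (q - y) * v (q + y) = (pi powr (- 1 / 4) * pi powr (- 1 / 4))
        * (exp (- (q - y)\<^sup>2 / 2) * exp (- (q + y)\<^sup>2 / 2))"
      by (simp add: v_def)
    also have "\<dots> = pi powr (- 1 / 2) * exp (- q\<^sup>2 + - y\<^sup>2)"
      by (simp add: power2_eq_square field_simps flip: powr_add exp_add)
    also have "exp (- q\<^sup>2 + - y\<^sup>2) = exp (- q\<^sup>2) * exp (- y\<^sup>2)"
      by (rule exp_add)
    also have "pi powr (- 1 / 2) = 1 / sqrt pi"
      by (simp add: powr_minus_divide powr_half_sqrt)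
    finally show ?thesis
      by (simp add: half_normal_eq)
  qed
  have "sigma_state t l (q - y) (q + y) = of_real ((v (q - y) * v (q + y)
      + t\<^sup>2 * (g (q - y) * v (q - y) * (g (q + y) * v (q + y)))
      + l * t * (v (q - y) * (g (q + y) * v (q + y)) + g (q - y) * v (q - y) * v (q + y))) / (1 + t\<^sup>2))"
    unfolding sigma_state_def ketbra_def fock_0 f3 unfolding vac by simp
  also have "v (q - y) * v (q + y)
      + t\<^sup>2 * (g (q - y) * v (q - y) * (g (q + y) * v (q + y)))
      + l * t * (v (q - y) * (g (q + y) * v (q + y)) + g (q - y) * v (q - y) * v (q + y))
    = v (q - y) * v (q + y) * (1 + t\<^sup>2 * (g (q - y) * g (q + y)) + l * t * (g (q - y) + g (q + y)))"
    by (simp add: algebra_simps)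
  also have "g (q - y) * g (q + y) = h (q - y) * h (q + y) / 3"
    by (simp add: g_def)
  also have "g (q - y) + g (q + y) = (h (q - y) + h (q + y)) / sqrt 3"
    by (simp add: g_def add_divide_distrib)
  also have "h (q - y) * h (q + y) = (4 * q ^ 6 - 12 * q ^ 4 + 9 * q\<^sup>2)
      + (- 12 * q ^ 4 - 9) * y\<^sup>2 + (12 * q\<^sup>2 + 12) * y ^ 4 - 4 * y ^ 6"
    unfolding h_def by algebra
  also have "h (q - y) + h (q + y) = (4 * q ^ 3 - 6 * q) + 12 * q * y\<^sup>2"
    unfolding h_def by algebra
  finally show ?thesis
    unfolding vv by (simp add: algebra_simps add_divide_distrib diff_divide_distrib)
qed

lemma normal_fourier_even:
  "normal_fourier p 2 = of_real ((1 / 2 - p\<^sup>2) * exp (- p\<^sup>2))"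
  "normal_fourier p 4 = of_real ((p ^ 4 - 3 * p\<^sup>2 + 3 / 4) * exp (- p\<^sup>2))"
  "normal_fourier p 6 = of_real ((15 / 2 * p ^ 4 - p ^ 6 - 45 / 4 * p\<^sup>2 + 15 / 8) * exp (- p\<^sup>2))"
proof -
  have 1: "normal_fourier p (Suc 0) = \<i> * of_real (p * exp (- p\<^sup>2))"
    using normal_fourier_rec[of p 0] by (simp add: normal_fourier_0)
  have 2: "normal_fourier p 2 = of_real ((1 / 2 - p\<^sup>2) * exp (- p\<^sup>2))"
    using normal_fourier_rec[of p 1]
    by (simp add: numeral_2_eq_2 1 normal_fourier_0 complex_eq_iff algebra_simps power_numeral_even power_numeral_odd)
  have 3: "normal_fourier p 3 = \<i> * of_real ((3 / 2 * p - p ^ 3) * exp (- p\<^sup>2))"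
    using normal_fourier_rec[of p 2]
    by (simp add: 1 2 complex_eq_iff algebra_simps power_numeral_even power_numeral_odd)
  have 4: "normal_fourier p 4 = of_real ((p ^ 4 - 3 * p\<^sup>2 + 3 / 4) * exp (- p\<^sup>2))"
    using normal_fourier_rec[of p 3]
    by (simp add: 2 3 complex_eq_iff algebra_simps power_numeral_even power_numeral_odd)
  have 5: "normal_fourier p 5 = \<i> * of_real ((p ^ 5 - 5 * p ^ 3 + 15 / 4 * p) * exp (- p\<^sup>2))"
    using normal_fourier_rec[of p 4]
    by (simp add: 3 4 complex_eq_iff algebra_simps power_numeral_even power_numeral_odd)
  have 6: "normal_fourier p 6 = of_real ((15 / 2 * p ^ 4 - p ^ 6 - 45 / 4 * p\<^sup>2 + 15 / 8) * exp (- p\<^sup>2))"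
    using normal_fourier_rec[of p 5]
    by (simp add: 4 5 complex_eq_iff algebra_simps power_numeral_even power_numeral_odd)
  show "normal_fourier p 2 = of_real ((1 / 2 - p\<^sup>2) * exp (- p\<^sup>2))"
    "normal_fourier p 4 = of_real ((p ^ 4 - 3 * p\<^sup>2 + 3 / 4) * exp (- p\<^sup>2))"
    "normal_fourier p 6 = of_real ((15 / 2 * p ^ 4 - p ^ 6 - 45 / 4 * p\<^sup>2 + 15 / 8) * exp (- p\<^sup>2))"
    by (rule 2 4 6)+
qed

text \<open>Inserting the moments of orders 0, 2, 4, 6 makes the \<open>t\<^sup>2\<close> part
  radial: \<open>F_poly\<close> at r^2 is - L_3 (2 r^2) with the Laguerre polynomial L_3, as
  expected for the Fock state 3.\<close>

lemma wigner_sigma_state: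
  "wigner (sigma_state t l) z = exp (- (norm z)\<^sup>2) / pi * wigner_poly t l z"
proof -
  obtain q p where z: "z = (q, p)" by force
  define a0 where "a0 = (1 + t\<^sup>2 / 3 * (4 * q ^ 6 - 12 * q ^ 4 + 9 * q\<^sup>2) + l * t / sqrt 3 * (4 * q ^ 3 - 6 * q))"
  define a2 where "a2 = (t\<^sup>2 / 3 * (- 12 * q ^ 4 - 9) + l * t / sqrt 3 * (12 * q))"
  define a4 where "a4 = t\<^sup>2 / 3 * (12 * q\<^sup>2 + 12)"
  define a6 where "a6 = t\<^sup>2 / 3 * 4"
  define c where "c = exp (- q\<^sup>2) / (1 + t\<^sup>2)"
  define f where "f = (\<lambda>k y. complex_of_real (half_normal y * y ^ k) * exp (2 * \<i> * of_real p * of_real y))"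
  have int: "integrable lborel (f k)" for k
    unfolding f_def by (rule integrable_normal_fourier)
  have M: "integral\<^sup>L lborel (f k) = normal_fourier p k" for k
    unfolding f_def normal_fourier_def ..
  have "exp (2 * \<i> * of_real p * of_real y) * sigma_state t l (q - y) (q + y)
      = of_real c * (of_real a0 * f 0 y + of_real a2 * f 2 y + of_real a4 * f 4 y - of_real a6 * f 6 y)" for y
    unfolding sigma_state_eq a0_def[symmetric] a2_def[symmetric] a4_def[symmetric] a6_def[symmetric]
    by (simp add: c_def f_def divide_simps) (simp add: algebra_simps)
  then have "(LINT y|lborel. exp (2 * \<i> * of_real p * of_real y) * sigma_state t l (q - y) (q + y))
      = of_real c * (of_real a0 * normal_fourier p 0 + of_real a2 * normal_fourier p 2
          + of_real a4 * normal_fourier p 4 - of_real a6 * normal_fourier p 6)"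
    by (simp add: int M)
  also have "\<dots> = of_real (c * exp (- p\<^sup>2) * (a0 + a2 * (1 / 2 - p\<^sup>2) + a4 * (p ^ 4 - 3 * p\<^sup>2 + 3 / 4)
      - a6 * (15 / 2 * p ^ 4 - p ^ 6 - 45 / 4 * p\<^sup>2 + 15 / 8)))"
    unfolding normal_fourier_0 normal_fourier_even of_real_mult[symmetric] of_real_add[symmetric] of_real_diff[symmetric]
    by (rule arg_cong[of _ _ of_real]) (simp only: algebra_simps)
  finally have "wigner (sigma_state t l) z = c * exp (- p\<^sup>2) * (a0 + a2 * (1 / 2 - p\<^sup>2)
      + a4 * (p ^ 4 - 3 * p\<^sup>2 + 3 / 4) - a6 * (15 / 2 * p ^ 4 - p ^ 6 - 45 / 4 * p\<^sup>2 + 15 / 8)) / pi"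
    unfolding wigner_def z by (simp add: Re_divide_of_real)
  also have "(a0 + a2 * (1 / 2 - p\<^sup>2)
      + a4 * (p ^ 4 - 3 * p\<^sup>2 + 3 / 4) - a6 * (15 / 2 * p ^ 4 - p ^ 6 - 45 / 4 * p\<^sup>2 + 15 / 8))
      = 1 + t\<^sup>2 * F_poly (q\<^sup>2 + p\<^sup>2) + l * t * (4 / sqrt 3 * (q ^ 3 - 3 * q * p\<^sup>2))"
    unfolding a0_def a2_def a4_def a6_def F_poly_def
    by (simp add: algebra_simps power2_eq_square power3_eq_cube eval_nat_numeral add_divide_distrib diff_divide_distrib)
  finally show ?thesis
    unfolding wigner_poly_def cubic_harmonic_def z by (simp add: c_def norm_Pair exp_add[symmetric])
qed

section \<open>Gaussian means of polynomials\<close>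

lemma (in pair_sigma_finite)
  fixes f :: "'a \<Rightarrow> real" and g :: "'b \<Rightarrow> real"
  assumes f: "integrable M1 f" and g: "integrable M2 g"
  shows integrable_mult_pair: "integrable (M1 \<Otimes>\<^sub>M M2) (\<lambda>(x, y). f x * g y)"
    and integral_mult_pair: "integral\<^sup>L (M1 \<Otimes>\<^sub>M M2) (\<lambda>(x, y). f x * g y) = integral\<^sup>L M1 f * integral\<^sup>L M2 g"
proof -
  have [measurable]: "f \<in> borel_measurable M1" "g \<in> borel_measurable M2"
    using f g by auto
  show 1: "integrable (M1 \<Otimes>\<^sub>M M2) (\<lambda>(x, y). f x * g y)"
    by (rule Fubini_integrable) (use f g in \<open>auto simp: abs_mult\<close>)
  show "integral\<^sup>L (M1 \<Otimes>\<^sub>M M2) (\<lambda>(x, y). f x * g y) = integral\<^sup>L M1 f * integral\<^sup>L M2 g"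
    using integral_fst'[OF 1] by simp
qed

text \<open>The Wigner function of the vacuum as a probability measure;
  \<open>wigner_poly t l\<close> is the density of the Wigner function of the state with respect to
  it.\<close>

definition gauss_measure :: "(real \<times> real) measure" where
  "gauss_measure = density lborel (\<lambda>z. ennreal (exp (- (norm z)\<^sup>2) / pi))"

lemma gauss_measure_prod:
  "gauss_measure = density lborel half_normal \<Otimes>\<^sub>M density lborel half_normal"
proof -
  have e: "half_normal x * half_normal y = exp (- (norm (x, y))\<^sup>2) / pi" for x y
    by (simp add: half_normal_eq norm_Pair exp_diff exp_minus field_simps)
  interpret N: prob_space "density lborel half_normal"
    by (rule prob_space_normal_density) simp
  have "density lborel half_normal \<Otimes>\<^sub>M density lborel half_normal
      = density (lborel \<Otimes>\<^sub>M lborel) (\<lambda>(x, y). ennreal (half_normal x) * ennreal (half_normal y))"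
    by (rule pair_measure_density) (auto intro: lborel.sigma_finite_measure_axioms N.sigma_finite_measure_axioms)
  also have "\<dots> = gauss_measure"
    unfolding gauss_measure_def lborel_prod
    by (intro arg_cong2[where f = density] refl ext)
      (auto simp: e simp flip: ennreal_mult)
  finally show ?thesis ..
qed

lemma space_gauss [simp]: "space gauss_measure = UNIV"
  and sets_gauss [measurable_cong, simp]: "sets gauss_measure = sets borel"
  by (simp_all add: gauss_measure_def)

lemma integral_gauss:
  fixes f :: "real \<times> real \<Rightarrow> real"
  assumes [measurable]: "f \<in> borel_measurable borel"
  shows "integral\<^sup>L gauss_measure f = (LINT z|lborel. exp (- (norm z)\<^sup>2) / pi * f z)"
  unfolding gauss_measure_def by (subst integral_density) auto

interpretation gauss: prob_space gauss_measure
proof -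
  interpret N: prob_space "density lborel half_normal"
    by (rule prob_space_normal_density) simp
  interpret P: pair_prob_space "density lborel half_normal" "density lborel half_normal" ..
  show "prob_space gauss_measure"
    unfolding gauss_measure_prod by (rule P.prob_space_axioms)
qed

lemma integral_gauss_uminus:
  fixes f :: "real \<times> real \<Rightarrow> real"
  assumes [measurable]: "f \<in> borel_measurable borel"
  shows "(LINT z|gauss_measure. f (- z)) = integral\<^sup>L gauss_measure f"
proof -
  have d: "lborel = distr lborel borel (\<lambda>z :: real \<times> real. - z)"
    using lborel_affine[of "-1" "0 :: real \<times> real"] by (simp add: density_1)
  have "integral\<^sup>L gauss_measure f = (LINT z|distr lborel borel (\<lambda>z. - z). exp (- (norm z)\<^sup>2) / pi * f z)"
    by (subst integral_gauss) (simp_all flip: d)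
  also have "\<dots> = (LINT z|lborel. exp (- (norm z)\<^sup>2) / pi * f (- z))"
    by (subst integral_distr) auto
  also have "\<dots> = (LINT z|gauss_measure. f (- z))"
    by (subst integral_gauss) auto
  finally show ?thesis ..
qed

lemma integral_gauss_odd:
  fixes f :: "real \<times> real \<Rightarrow> real"
  assumes "f \<in> borel_measurable borel" "\<And>z. f (- z) = - f z"
  shows "integral\<^sup>L gauss_measure f = 0"
  using integral_gauss_uminus[OF assms(1)] by (simp add: assms(2))

lemma integral_gauss_swap:
  fixes f :: "real \<times> real \<Rightarrow> real"
  assumes [measurable]: "f \<in> borel_measurable borel"
  shows "(LINT z|gauss_measure. f (snd z, fst z)) = integral\<^sup>L gauss_measure f"
proof -
  interpret N: prob_space "density lborel half_normal"
    by (rule prob_space_normal_density) simp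
  interpret P: pair_prob_space "density lborel half_normal" "density lborel half_normal" ..
  have "f \<in> borel_measurable (borel \<Otimes>\<^sub>M borel)"
    unfolding borel_prod by (rule assms)
  then show ?thesis
    unfolding gauss_measure_prod
    using P.integral_product_swap[of f]
    by (simp add: case_prod_unfold gauss_measure_prod[symmetric] cong: measurable_cong_sets)
qed

section \<open>Radial moments and integrability of polynomials\<close>

text \<open>The familiar value (2k)! / (4^k k!) is put as a rising factorial so that the binomial
  identity for rising factorials applies to moments of the norm.\<close>

lemma half_normal_moment_even:
  "integral\<^sup>L (density lborel half_normal) (\<lambda>x. x ^ (2 * k)) = pochhammer (1 / 2) k"
proof -
  have "integral\<^sup>L (density lborel half_normal) (\<lambda>x. x ^ (2 * k)) = (LINT x|lborel. half_normal x * (x - 0) ^ (2 * k))"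
    by (subst integral_density) auto
  also have "\<dots> = fact (2 * k) / ((2 / (sqrt (1 / 2))\<^sup>2) ^ k * fact k)"
    by (rule integral_normal_moment_even) simp
  also have "\<dots> = pochhammer (1 / 2) k"
    by (simp add: fact_double power_mult)
  finally show ?thesis .
qed

lemma integrable_half_normal_power:
  "integrable (density lborel half_normal) (\<lambda>x. x ^ k)"
  using integrable_normal_moment[of "sqrt (1 / 2)" 0 k] by (subst integrable_density) auto

text \<open>The squared radius is exponentially distributed with mean 1. Instead of polar
  coordinates, (q^2 + p^2)^n is expanded binomially; the products of rising factorials of 1/2 add up
  to the rising factorial of 1, which is n!.\<close>

lemma has_bochner_integral_gauss_norm_power:
  "has_bochner_integral gauss_measure (\<lambda>z. ((norm z)\<^sup>2) ^ n) (fact n)"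
proof -
  let ?N = "density lborel half_normal"
  interpret N: prob_space ?N
    by (rule prob_space_normal_density) simp
  interpret P: pair_prob_space ?N ?N ..
  have b: "has_bochner_integral gauss_measure (\<lambda>z. fst z ^ (2 * k) * snd z ^ (2 * (n - k)))
      (pochhammer (1 / 2) k * pochhammer (1 / 2) (n - k))" for k
    unfolding has_bochner_integral_iff gauss_measure_prod half_normal_moment_even[symmetric]
    using P.integrable_mult_pair[OF integrable_half_normal_power[of "2 * k"] integrable_half_normal_power[of "2 * (n - k)"]]
      P.integral_mult_pair[OF integrable_half_normal_power[of "2 * k"] integrable_half_normal_power[of "2 * (n - k)"]]
    by (simp add: case_prod_unfold)
  have "has_bochner_integral gauss_measure
      (\<lambda>z. \<Sum>k\<le>n. of_nat (n choose k) * (fst z ^ (2 * k) * snd z ^ (2 * (n - k))))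
      (\<Sum>k\<le>n. of_nat (n choose k) * (pochhammer (1 / 2) k * pochhammer (1 / 2) (n - k)))"
    by (intro has_bochner_integral_sum has_bochner_integral_mult_right b)
  also have "(\<lambda>z. \<Sum>k\<le>n. of_nat (n choose k) * (fst z ^ (2 * k) * snd z ^ (2 * (n - k))))
      = (\<lambda>z :: real \<times> real. ((norm z)\<^sup>2) ^ n)"
    by (simp add: fun_eq_iff norm_Pair binomial_ring power_mult mult.assoc)
  also have "(\<Sum>k\<le>n. of_nat (n choose k) * (pochhammer (1 / 2) k * pochhammer (1 / 2) (n - k))) = (fact n :: real)"
    using pochhammer_binomial_sum[of "1 / 2 :: real" "1 / 2" n]
    by (simp add: pochhammer_fact mult.assoc)
  finally show ?thesis .
qed

lemma integral_gauss_poly_norm: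
  "integral\<^sup>L gauss_measure (\<lambda>z. poly P ((norm z)\<^sup>2)) = (\<Sum>i\<le>degree P. coeff P i * fact i)"
proof -
  have "has_bochner_integral gauss_measure (\<lambda>z. poly P ((norm z)\<^sup>2)) (\<Sum>i\<le>degree P. coeff P i * fact i)"
    unfolding poly_altdef
    by (intro has_bochner_integral_sum has_bochner_integral_mult_right has_bochner_integral_gauss_norm_power)
  then show ?thesis
    by (rule has_bochner_integral_integral_eq)
qed

text \<open>Bounds of this shape are stable under sums and products, and the radial moments make
  them integrable under \<open>gauss_measure\<close>.\<close>

lemma real_polynomial_function_bound:
  assumes "real_polynomial_function f"
  shows "\<exists>C n. \<forall>z. \<bar>f z\<bar> \<le> C * (1 + (norm z)\<^sup>2) ^ n"
  using assms
proof induction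
  case (linear f)
  then obtain K where K: "0 < K" "\<And>z. norm (f z) \<le> norm z * K"
    using bounded_linear.pos_bounded by blast
  have "\<bar>f z\<bar> \<le> K * (1 + (norm z)\<^sup>2) ^ 1" for z
  proof -
    have "norm z \<le> 1 + (norm z)\<^sup>2"
      using sum_squares_bound[of "norm z" 1] norm_ge_zero[of z] unfolding power_one mult_1_right by linarith
    with K(1) have "norm z * K \<le> (1 + (norm z)\<^sup>2) * K"
      by (intro mult_right_mono) auto
    then show ?thesis
      using K(2)[of z] by (simp add: mult.commute)
  qed
  then show ?case by blast
next
  case (const c)
  have "\<bar>c\<bar> \<le> \<bar>c\<bar> * (1 + (norm z)\<^sup>2) ^ 0" for z :: 'a by simp
  then show ?case by blast
next
  case (add f g)
  then obtain C m D n where f: "\<And>z. \<bar>f z\<bar> \<le> C * (1 + (norm z)\<^sup>2) ^ m"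
    and g: "\<And>z. \<bar>g z\<bar> \<le> D * (1 + (norm z)\<^sup>2) ^ n"
    by blast
  \<comment> \<open>The base is at least 1, so the exponent m + n dominates both summands.\<close>
  have "\<bar>f z + g z\<bar> \<le> (\<bar>C\<bar> + \<bar>D\<bar>) * (1 + (norm z)\<^sup>2) ^ (m + n)" for z
  proof -
    have "C * (1 + (norm z)\<^sup>2) ^ m \<le> \<bar>C\<bar> * (1 + (norm z)\<^sup>2) ^ (m + n)"
      by (intro mult_mono power_increasing) auto
    moreover have "D * (1 + (norm z)\<^sup>2) ^ n \<le> \<bar>D\<bar> * (1 + (norm z)\<^sup>2) ^ (m + n)"
      by (intro mult_mono power_increasing) auto
    ultimately show ?thesis
      using f[of z] g[of z] by (simp add: distrib_right)
  qed
  then show ?case by blast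
next
  case (mult f g)
  then obtain C m D n where f: "\<And>z. \<bar>f z\<bar> \<le> C * (1 + (norm z)\<^sup>2) ^ m"
    and g: "\<And>z. \<bar>g z\<bar> \<le> D * (1 + (norm z)\<^sup>2) ^ n"
    by blast
  have "\<bar>f z * g z\<bar> \<le> (C * D) * (1 + (norm z)\<^sup>2) ^ (m + n)" for z
    using mult_mono[OF f[of z] g[of z]] f[of z]
    by (simp add: abs_mult power_add mult_ac)
  then show ?case by blast
qed

lemma borel_measurable_polynomial:
  fixes f :: "real \<times> real \<Rightarrow> real"
  assumes "real_polynomial_function f"
  shows "f \<in> borel_measurable borel"
  using assms by (intro borel_measurable_continuous_onI continuous_on_polymonial_function)
    (simp flip: real_polynomial_function_eq)

lemma integrable_gauss_polynomial:
  fixes f :: "real \<times> real \<Rightarrow> real"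
  assumes "real_polynomial_function f"
  shows "integrable gauss_measure f"
proof -
  from real_polynomial_function_bound[OF assms]
  obtain C n where C: "\<And>z. \<bar>f z\<bar> \<le> C * (1 + (norm z)\<^sup>2) ^ n"
    by blast
  have [measurable]: "f \<in> borel_measurable borel"
    using assms by (rule borel_measurable_polynomial)
  have "integrable gauss_measure (\<lambda>z. C * (1 + (norm z)\<^sup>2) ^ n)"
    unfolding add.commute[of 1] binomial_ring
    by (intro integrable_mult_right Bochner_Integration.integrable_sum)
      (auto intro!: integrable_mult_right integrable_mult_left has_bochner_integral_gauss_norm_power[THEN integrable.intros])
  then show ?thesis
    by (rule Bochner_Integration.integrable_bound) (auto simp: C intro!: AE_I2 order_trans[OF C abs_ge_self])
qed

section \<open>Positivity\<close>

text \<open>The critical point equation of \<open>pos_bound t\<close>: this polynomial carries the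
  sign of the derivative.\<close>

definition crit_poly :: "real \<Rightarrow> real \<Rightarrow> real" where
  "crit_poly t x = t\<^sup>2 * (4 * x ^ 3 - 6 * x\<^sup>2 - 6 * x + 3) - 3"

text \<open>Dividing by \<open>x\<^sup>2\<close> turns every term of \<open>crit_poly t\<close> into an increasing function of \<open>x > 0\<close>.\<close>

lemma crit_poly_mono:
  assumes t: "0 < t" "t < 1" and xy: "0 < x" "x < y"
  shows "crit_poly t x / x\<^sup>2 < crit_poly t y / y\<^sup>2"
proof -
  have e: "crit_poly t x / x\<^sup>2 = t\<^sup>2 * (4 * x) - 6 * t\<^sup>2 - 6 * t\<^sup>2 * (1 / x) - (3 - 3 * t\<^sup>2) * (1 / x\<^sup>2)" if "0 < x" for x
    using that by (simp add: crit_poly_def field_simps power2_eq_square power3_eq_cube)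
  have t2: "0 < t\<^sup>2" "t\<^sup>2 < 1"
    using t by (auto simp: power_less_one_iff)
  have "t\<^sup>2 * (4 * x) < t\<^sup>2 * (4 * y)"
    using t2 xy by simp
  moreover have "6 * t\<^sup>2 * (1 / y) \<le> 6 * t\<^sup>2 * (1 / x)"
    using t2 xy by (intro mult_left_mono) (auto simp: frac_le)
  moreover have "(3 - 3 * t\<^sup>2) * (1 / y\<^sup>2) \<le> (3 - 3 * t\<^sup>2) * (1 / x\<^sup>2)"
    using t2 xy by (intro mult_left_mono frac_le power_mono) auto
  ultimately show ?thesis
    using xy by (simp only: e)
qed

text \<open>A root exists by the intermediate value theorem, and the monotone quotient by x^2 fixes
  the sign on either side of it.\<close>

lemma crit_poly_root:
  assumes t: "0 < t" "t < 1"
  obtains x where "0 < x" "crit_poly t x = 0"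
    "\<And>y. 0 < y \<Longrightarrow> y < x \<Longrightarrow> crit_poly t y < 0" "\<And>y. x < y \<Longrightarrow> 0 < crit_poly t y"
proof -
  have t2: "0 < t\<^sup>2" "t\<^sup>2 < 1"
    using t by (auto simp: power_less_one_iff)
  \<comment> \<open>An upper end for the intermediate value theorem: t^2 m = 3, and m >= 3 makes the
    cubic factor at least m, so \<open>crit_poly t m\<close> is nonnegative.\<close>
  define m where "m = 3 / t\<^sup>2"
  have m: "3 \<le> m" "t\<^sup>2 * m = 3"
    using t2 by (auto simp: m_def field_simps)
  have "6 * m\<^sup>2 \<le> 2 * m ^ 3"
    using mult_right_mono[OF m(1), of "2 * m\<^sup>2"] by (simp add: power2_eq_square power3_eq_cube)
  moreover have "9 \<le> m\<^sup>2"
    using power_mono[OF m(1), of 2] by simp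
  then have "9 * m \<le> m ^ 3"
    using mult_right_mono[of 9 "m\<^sup>2" m] m by (simp add: power2_eq_square power3_eq_cube)
  ultimately have "m \<le> 4 * m ^ 3 - 6 * m\<^sup>2 - 6 * m + 3"
    using m by linarith
  then have "t\<^sup>2 * m \<le> t\<^sup>2 * (4 * m ^ 3 - 6 * m\<^sup>2 - 6 * m + 3)"
    using t2 by (intro mult_left_mono) auto
  then have "0 \<le> crit_poly t m"
    using m by (simp add: crit_poly_def)
  moreover have 0: "crit_poly t 0 < 0"
    using t2 by (simp add: crit_poly_def)
  moreover have "continuous_on {0..m} (crit_poly t)"
    unfolding crit_poly_def by (intro continuous_intros)
  ultimately obtain x where x: "0 \<le> x" "x \<le> m" "crit_poly t x = 0"
    using IVT'[of "crit_poly t" 0 0 m] m by auto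
  with 0 have "0 < x"
    by (cases "x = 0") auto
  show ?thesis
  proof (rule that)
    show "crit_poly t y < 0" if "0 < y" "y < x" for y
      using crit_poly_mono[OF t that] x(3) that by (simp add: divide_less_0_iff)
    show "0 < crit_poly t y" if "x < y" for y
      using crit_poly_mono[OF t \<open>0 < x\<close> that] x(3) that by (simp add: zero_less_divide_iff)
  qed (use x \<open>0 < x\<close> in auto)
qed

text \<open>Differentiate (1 + t^2 F) x^(-3/2) and pull out x^(-5/2); what is left, x t^2 F' - 3/2
  (1 + t^2 F), equals half of \<open>crit_poly t x\<close>.\<close>

lemma pos_bound_deriv:
  assumes "0 < t" "0 < x"
  shows "(pos_bound t has_real_derivative sqrt 3 / (8 * t) * x powr (- 5 / 2) * crit_poly t x) (at x)"
proof -
  have F: "(F_poly has_real_derivative (6 - 12 * x + 4 * x\<^sup>2)) (at x)"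
    unfolding F_poly_def[abs_def] by (auto intro!: derivative_eq_intros)
  have p1: "x powr (- 3 / 2) = x * x powr (- 5 / 2)"
    using assms powr_mult_base[of x "- 5 / 2"] by simp
  have "((\<lambda>x. sqrt 3 / (4 * t) * ((1 + t\<^sup>2 * F_poly x) * x powr (- 3 / 2))) has_real_derivative
      sqrt 3 / (4 * t) * (t\<^sup>2 * (6 - 12 * x + 4 * x\<^sup>2) * x powr (- 3 / 2)
        + (- 3 / 2 * x powr (- 5 / 2)) * (1 + t\<^sup>2 * F_poly x))) (at x)"
    using assms by (auto intro!: derivative_eq_intros F)
  also have "(t\<^sup>2 * (6 - 12 * x + 4 * x\<^sup>2) * x powr (- 3 / 2)
        + (- 3 / 2 * x powr (- 5 / 2)) * (1 + t\<^sup>2 * F_poly x)) = x powr (- 5 / 2) * crit_poly t x / 2"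
    unfolding p1 by (simp add: F_poly_def crit_poly_def field_simps power2_eq_square power3_eq_cube)
  also have "(\<lambda>x. sqrt 3 / (4 * t) * ((1 + t\<^sup>2 * F_poly x) * x powr (- 3 / 2))) = pos_bound t"
    by (simp add: fun_eq_iff pos_bound_def powr_minus_divide)
  finally show ?thesis by (simp add: mult.assoc)
qed

text \<open>By the sign of its derivative, \<open>pos_bound t\<close> decreases up to the root of
  \<open>crit_poly t\<close> and increases beyond it.\<close>

lemma pos_bound_min:
  assumes t: "0 < t" "t < 1"
  obtains x where "0 < x" "crit_poly t x = 0" "\<And>y. 0 < y \<Longrightarrow> crit_poly t y = 0 \<Longrightarrow> y = x"
    "\<And>y. 0 < y \<Longrightarrow> pos_bound t x \<le> pos_bound t y"
proof -
  obtain x where x: "0 < x" "crit_poly t x = 0"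
    "\<And>y. 0 < y \<Longrightarrow> y < x \<Longrightarrow> crit_poly t y < 0" "\<And>y. x < y \<Longrightarrow> 0 < crit_poly t y"
    using crit_poly_root[OF t] by blast
  show ?thesis
  proof (rule that)
    show "y = x" if "0 < y" "crit_poly t y = 0" for y
      using x(3)[of y] x(4)[of y] that by (cases y x rule: linorder_cases) auto
    show "pos_bound t x \<le> pos_bound t y" if "0 < y" for y
    proof (cases "y \<le> x")
      case True
      then show ?thesis
      proof (rule DERIV_nonpos_imp_nonincreasing)
        fix u assume u: "y \<le> u" "u \<le> x"
        then have "crit_poly t u \<le> 0"
          using x(2) x(3)[of u] that by (cases "u = x") auto
        then show "\<exists>d. (pos_bound t has_real_derivative d) (at u) \<and> d \<le> 0"
          using u that t by (intro exI[where x = "sqrt 3 / (8 * t) * u powr (- 5 / 2) * crit_poly t u"] conjI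
              pos_bound_deriv mult_nonneg_nonpos) auto
      qed
    next
      case False
      then have "x \<le> y" by simp
      then show ?thesis
      proof (rule DERIV_nonneg_imp_nondecreasing)
        fix u assume u: "x \<le> u" "u \<le> y"
        then have "0 \<le> crit_poly t u"
          using x(2) x(4)[of u] by (cases "u = x") auto
        then show "\<exists>d. (pos_bound t has_real_derivative d) (at u) \<and> 0 \<le> d"
          using pos_bound_deriv[of t u] u x(1) t by (auto intro!: exI)
      qed
    qed
  qed (use x in auto)
qed

lemma lambda_pos_eqI:
  assumes "0 < x" "\<And>y. 0 < y \<Longrightarrow> pos_bound t x \<le> pos_bound t y"
  shows "lambda_pos t = pos_bound t x"
  unfolding lambda_pos_def using assms by (intro cInf_eq_minimum) auto

lemma lambda_pos_le:
  assumes "0 < t" "t < 1" "0 < y"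
  shows "lambda_pos t \<le> pos_bound t y"
  using pos_bound_min[OF assms(1,2)] lambda_pos_eqI assms(3) by metis

text \<open>With x = r^2 the power x^(3/2) is r^3. The right-hand sides compare the radial part of
  the numerator of \<open>wigner_poly\<close> with the largest size of its angular part on the
  circle of radius r, for nonnegative l.\<close>

lemma pos_bound_iff:
  assumes "0 < t" "0 < r"
  shows "l \<le> pos_bound t (r\<^sup>2) \<longleftrightarrow> l * t * (4 / sqrt 3 * r ^ 3) \<le> 1 + t\<^sup>2 * F_poly (r\<^sup>2)"
    and "l < pos_bound t (r\<^sup>2) \<longleftrightarrow> l * t * (4 / sqrt 3 * r ^ 3) < 1 + t\<^sup>2 * F_poly (r\<^sup>2)"
proof -
  have "(r\<^sup>2) powr (3 / 2) = r ^ 3"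
    using assms powr_powr[of r 2 "3 / 2"] powr_realpow[of r 3] powr_realpow[of r 2] by simp
  then have e: "pos_bound t (r\<^sup>2) = sqrt 3 * (1 + t\<^sup>2 * F_poly (r\<^sup>2)) / (4 * t * r ^ 3)"
    by (simp add: pos_bound_def)
  show "l \<le> pos_bound t (r\<^sup>2) \<longleftrightarrow> l * t * (4 / sqrt 3 * r ^ 3) \<le> 1 + t\<^sup>2 * F_poly (r\<^sup>2)"
    using assms unfolding e by (simp add: field_simps)
  show "l < pos_bound t (r\<^sup>2) \<longleftrightarrow> l * t * (4 / sqrt 3 * r ^ 3) < 1 + t\<^sup>2 * F_poly (r\<^sup>2)"
    using assms unfolding e by (simp add: field_simps)
qed

text \<open>For w = q + i p this is |Re (w^3)| <= |w|^3, obtained by writing |w|^6 as the sum of the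
  squares of the real and imaginary parts of w^3.\<close>

lemma abs_cubic_harmonic_le: "\<bar>cubic_harmonic z\<bar> \<le> 4 / sqrt 3 * norm z ^ 3"
proof -
  obtain q p where z: "z = (q, p)" by force
  have "(norm z ^ 3)\<^sup>2 = ((norm z)\<^sup>2) ^ 3"
    by (simp flip: power_mult)
  also have "\<dots> = (q\<^sup>2 + p\<^sup>2) ^ 3"
    by (simp add: z norm_Pair)
  also have "\<dots> = (q ^ 3 - 3 * q * p\<^sup>2)\<^sup>2 + (3 * q\<^sup>2 * p - p ^ 3)\<^sup>2"
    by algebra
  finally have "(q ^ 3 - 3 * q * p\<^sup>2)\<^sup>2 \<le> (norm z ^ 3)\<^sup>2"
    by simp
  then have "\<bar>q ^ 3 - 3 * q * p\<^sup>2\<bar> \<le> norm z ^ 3"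
    unfolding abs_le_square_iff[symmetric] by simp
  then show ?thesis
    unfolding cubic_harmonic_def z by (simp add: abs_mult mult_left_mono divide_right_mono)
qed

text \<open>Strict positivity keeps the logarithm away from zeros. Negative l are included because
  the monotonicity argument compares l with -l.\<close>

lemma wigner_poly_pos:
  assumes t: "0 < t" "t < 1" and l: "\<bar>l\<bar> < lambda_pos t"
  shows "0 < wigner_poly t l z"
proof -
  have "\<bar>l * t * cubic_harmonic z\<bar> = \<bar>l\<bar> * t * \<bar>cubic_harmonic z\<bar>"
    using t by (simp add: abs_mult)
  also have "\<dots> \<le> \<bar>l\<bar> * t * (4 / sqrt 3 * norm z ^ 3)"
    using t by (intro mult_left_mono abs_cubic_harmonic_le) auto
  also have "\<dots> < 1 + t\<^sup>2 * F_poly ((norm z)\<^sup>2)"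
  proof (cases "z = 0")
    \<comment> \<open>\<open>pos_bound\<close> controls only r > 0; at the origin the value is 1 -
      t^2.\<close>
    case True
    then show ?thesis
      using t by (simp add: F_poly_def power_less_one_iff)
  next
    case False
    then show ?thesis
      using pos_bound_iff(2)[of t "norm z" "\<bar>l\<bar>"] lambda_pos_le[OF t, of "(norm z)\<^sup>2"] t l by simp
  qed
  finally show ?thesis
    by (simp add: wigner_poly_def add_pos_nonneg)
qed

lemma wigner_poly_nonneg_iff:
  assumes t: "0 < t" "t < 1" and l: "0 \<le> l"
  shows "(\<forall>z. 0 \<le> wigner_poly t l z) \<longleftrightarrow> l \<le> lambda_pos t"
proof
  assume *: "\<forall>z. 0 \<le> wigner_poly t l z"
  obtain x where x: "0 < x" "\<And>y. 0 < y \<Longrightarrow> pos_bound t x \<le> pos_bound t y"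
    using pos_bound_min[OF t] by metis
  \<comment> \<open>On the minimising circle r^2 = x this is a point where the harmonic takes its
    least value, so the bound is sharp there.\<close>
  have "0 \<le> wigner_poly t l (- sqrt x, 0)"
    using * by blast
  moreover have "0 < 1 + t\<^sup>2"
    by (simp add: add_pos_nonneg)
  ultimately have "l * t * (4 / sqrt 3 * sqrt x ^ 3) \<le> 1 + t\<^sup>2 * F_poly ((sqrt x)\<^sup>2)"
    using x(1) by (simp add: wigner_poly_def cubic_harmonic_def norm_Pair zero_le_divide_iff)
  then show "l \<le> lambda_pos t"
    using pos_bound_iff(1)[of t "sqrt x" l] t x lambda_pos_eqI[OF x] by simp
next
  assume *: "l \<le> lambda_pos t"
  show "\<forall>z. 0 \<le> wigner_poly t l z"
  proof
    fix z
    have "\<bar>l * t * cubic_harmonic z\<bar> = l * t * \<bar>cubic_harmonic z\<bar>"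
      using t l by (simp add: abs_mult)
    also have "\<dots> \<le> l * t * (4 / sqrt 3 * norm z ^ 3)"
      using t l by (intro mult_left_mono abs_cubic_harmonic_le) auto
    also have "\<dots> \<le> 1 + t\<^sup>2 * F_poly ((norm z)\<^sup>2)"
    proof (cases "z = 0")
      case True
      then show ?thesis
        using t by (simp add: F_poly_def power_le_one_iff)
    next
      case False
      then show ?thesis
        using pos_bound_iff(1)[of t "norm z" l] lambda_pos_le[OF t, of "(norm z)\<^sup>2"] t * by simp
    qed
    finally show "0 \<le> wigner_poly t l z"
      by (simp add: wigner_poly_def)
  qed
qed

lemma wigner_nonneg_iff: "0 \<le> wigner (sigma_state t l) z \<longleftrightarrow> 0 \<le> wigner_poly t l z"
proof -
  have "0 < exp (- (norm z)\<^sup>2) / pi"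
    by simp
  then show ?thesis
    unfolding wigner_sigma_state zero_le_mult_iff by linarith
qed

section \<open>Inequalities for \<open>x ln x\<close>\<close>

text \<open>The graph lies strictly above its tangent at c: multiply ln (c/x) < c/x - 1 by
  x.\<close>

lemma xlnx_tangent:
  fixes x c :: real
  assumes "0 < x" "0 < c" "x \<noteq> c"
  shows "c * ln c + (ln c + 1) * (x - c) < x * ln x"
proof -
  have "ln (c / x) < c / x - 1"
    using ln_le_minus_one[of "c / x"] ln_eq_minus_one[of "c / x"] assms by fastforce
  then have "x * ln (c / x) < x * (c / x - 1)"
    using assms by simp
  then show ?thesis
    using assms by (simp add: ln_div algebra_simps)
qed

lemma xlnx_strictly_convex:
  fixes a b u :: real
  assumes "0 < a" "0 < b" "a \<noteq> b" "0 < u" "u < 1"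
  shows "((1 - u) * a + u * b) * ln ((1 - u) * a + u * b) < (1 - u) * (a * ln a) + u * (b * ln b)"
proof -
  define c where "c = (1 - u) * a + u * b"
  have c: "0 < c" "a \<noteq> c" "b \<noteq> c"
  proof -
    show "0 < c"
      using assms by (simp add: c_def add_pos_pos)
    have "a - c = u * (a - b)" "b - c = (1 - u) * (b - a)"
      by (simp_all add: c_def algebra_simps)
    then show "a \<noteq> c" "b \<noteq> c"
      using assms by auto
  qed
  have "(1 - u) * (c * ln c + (ln c + 1) * (a - c)) < (1 - u) * (a * ln a)"
    using xlnx_tangent[of a c] c assms by simp
  moreover have "u * (c * ln c + (ln c + 1) * (b - c)) < u * (b * ln b)"
    using xlnx_tangent[of b c] c assms by simp
  \<comment> \<open>Both tangents are taken at the convex combination c itself, so the slope terms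
    cancel in the weighted sum.\<close>
  moreover have "(1 - u) * (c * ln c + (ln c + 1) * (a - c)) + u * (c * ln c + (ln c + 1) * (b - c))
      = c * ln c + (ln c + 1) * ((1 - u) * a + u * b - c)"
    by (simp add: algebra_simps)
  ultimately show ?thesis
    unfolding c_def[symmetric] by simp
qed

lemma xlnx_convex:
  fixes a b u :: real
  assumes "0 < a" "0 < b" "0 < u" "u < 1"
  shows "((1 - u) * a + u * b) * ln ((1 - u) * a + u * b) \<le> (1 - u) * (a * ln a) + u * (b * ln b)"
proof (cases "a = b")
  case True
  then show ?thesis by (simp add: algebra_simps)
next
  case False
  then show ?thesis
    using xlnx_strictly_convex[of a b u] assms by simp
qed

text \<open>A polynomial majorant, which yields integrability of the entropy integrand.\<close>

lemma abs_xlnx_le: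
  fixes x :: real
  assumes "0 < x"
  shows "\<bar>x * ln x\<bar> \<le> x\<^sup>2 + 1"
proof -
  have "x * ln x \<le> x * (x - 1)"
    using ln_le_minus_one[OF assms] assms by simp
  moreover have "x - 1 \<le> x * ln x"
    using xlnx_tangent[of x 1] assms by (cases "x = 1") auto
  ultimately show ?thesis
    using assms by (simp add: abs_le_iff power2_eq_square algebra_simps) (smt (verit) mult_pos_pos)
qed

text \<open>The difference between ln and its quadratic Taylor polynomial at 1 vanishes at 1 and has
  derivative (u - 1)^2 / u >= 0.\<close>

lemma ln_cubic_bounds:
  fixes y :: real
  assumes "0 < y"
  shows "1 \<le> y \<Longrightarrow> (y - 1) - (y - 1)\<^sup>2 / 2 \<le> ln y" "y \<le> 1 \<Longrightarrow> ln y \<le> (y - 1) - (y - 1)\<^sup>2 / 2"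
proof -
  define k where "k = (\<lambda>y::real. ln y - (y - 1) + (y - 1)\<^sup>2 / 2)"
  have d: "(k has_real_derivative (u - 1)\<^sup>2 / u) (at u)" if "0 < u" for u
    unfolding k_def using that
    by (auto intro!: derivative_eq_intros simp: field_simps power2_eq_square)
  have m: "k a \<le> k b" if "0 < a" "a \<le> b" for a b
  proof (rule DERIV_nonneg_imp_nondecreasing[OF that(2)])
    fix u assume "a \<le> u" "u \<le> b"
    with that have "0 < u" by simp
    then show "\<exists>d. (k has_real_derivative d) (at u) \<and> 0 \<le> d"
      by (intro exI[where x = "(u - 1)\<^sup>2 / u"] conjI d) auto
  qed
  show "1 \<le> y \<Longrightarrow> (y - 1) - (y - 1)\<^sup>2 / 2 \<le> ln y"
    using m[of 1 y] by (simp add: k_def)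
  show "y \<le> 1 \<Longrightarrow> ln y \<le> (y - 1) - (y - 1)\<^sup>2 / 2"
    using m[of y 1] assms by (simp add: k_def)
qed

text \<open>The difference of the two sides vanishes at 1, and its derivative is ln minus its
  quadratic Taylor polynomial, which has the sign of u - 1. So 1 is a global minimum and the
  truncated Taylor series is a bound on all of y > 0.\<close>

lemma xlnx_ge_cubic:
  fixes y :: real
  assumes "0 < y"
  shows "(y - 1) + (y - 1)\<^sup>2 / 2 - (y - 1) ^ 3 / 6 \<le> y * ln y"
proof -
  define k where "k = (\<lambda>y::real. y * ln y - (y - 1) - (y - 1)\<^sup>2 / 2 + (y - 1) ^ 3 / 6)"
  have d: "(k has_real_derivative (ln u - ((u - 1) - (u - 1)\<^sup>2 / 2))) (at u)" if "0 < u" for u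
    unfolding k_def using that
    by (auto intro!: derivative_eq_intros simp: field_simps power2_eq_square)
  have "k 1 \<le> k y"
  proof (cases "1 \<le> y")
    case True
    then show ?thesis
    proof (rule DERIV_nonneg_imp_nondecreasing)
      fix u assume "1 \<le> u" "u \<le> y"
      then show "\<exists>d. (k has_real_derivative d) (at u) \<and> 0 \<le> d"
        using ln_cubic_bounds(1)[of u] by (intro exI[where x = "ln u - ((u - 1) - (u - 1)\<^sup>2 / 2)"] conjI d) auto
    qed
  next
    case False
    then have "y \<le> 1" by simp
    then show ?thesis
    proof (rule DERIV_nonpos_imp_nonincreasing)
      fix u assume "y \<le> u" "u \<le> 1"
      then show "\<exists>d. (k has_real_derivative d) (at u) \<and> d \<le> 0"
        using ln_cubic_bounds(2)[of u] assms by (intro exI[where x = "ln u - ((u - 1) - (u - 1)\<^sup>2 / 2)"] conjI d) auto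
    qed
  qed
  then show ?thesis
    by (simp add: k_def)
qed

section \<open>Moments of the deviation from the vacuum\<close>

abbreviation "gauss_mean \<equiv> integral\<^sup>L gauss_measure"

lemma real_polynomial_function_fst: "real_polynomial_function (\<lambda>z :: real \<times> real. fst z)"
  and real_polynomial_function_snd: "real_polynomial_function (\<lambda>z :: real \<times> real. snd z)"
  by (auto intro!: real_polynomial_function.intros(1) bounded_linear_fst bounded_linear_snd)

lemma real_polynomial_function_norm_squared:
  "real_polynomial_function (\<lambda>z :: real \<times> real. (norm z)\<^sup>2)"
  unfolding norm_prod_def
  by (simp, intro real_polynomial_function.intros(3) real_polynomial_function_power
      real_polynomial_function_fst real_polynomial_function_snd)

lemma real_polynomial_function_poly:
  assumes "real_polynomial_function f"
  shows "real_polynomial_function (\<lambda>z. poly P (f z))"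
  unfolding poly_altdef
  by (intro real_polynomial_function_sum real_polynomial_function.intros(2,4)
      real_polynomial_function_power assms) auto

lemma real_polynomial_function_cubic_harmonic: "real_polynomial_function cubic_harmonic"
  unfolding cubic_harmonic_def[abs_def]
  by (intro real_polynomial_function.intros(2-) real_polynomial_function_diff real_polynomial_function_power
      real_polynomial_function_fst real_polynomial_function_snd)

lemma real_polynomial_function_F_poly: "real_polynomial_function (\<lambda>z :: real \<times> real. F_poly ((norm z)\<^sup>2))"
  unfolding F_poly_def
  by (intro real_polynomial_function.intros(2-) real_polynomial_function_diff real_polynomial_function_power
      real_polynomial_function_norm_squared)

lemmas polynomial_intros =
  real_polynomial_function.intros(2-) real_polynomial_function_diff real_polynomial_function_power
  real_polynomial_function_divide real_polynomial_function_norm_squared real_polynomial_function_poly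
  real_polynomial_function_cubic_harmonic real_polynomial_function_F_poly

lemma real_polynomial_function_wigner_poly: "real_polynomial_function (wigner_poly t l)"
  unfolding wigner_poly_def[abs_def] by (intro polynomial_intros)

lemma wigner_poly_measurable [measurable]: "wigner_poly t l \<in> borel_measurable borel"
  by (intro borel_measurable_polynomial real_polynomial_function_wigner_poly)

lemma cubic_harmonic_uminus: "cubic_harmonic (- z) = - cubic_harmonic z"
  by (simp add: cubic_harmonic_def algebra_simps)

lemma wigner_poly_uminus: "wigner_poly t (- l) z = wigner_poly t l (- z)"
  by (simp add: wigner_poly_def cubic_harmonic_uminus)

text \<open>
  The squares of \<open>H\<close> and of \<open>H\<close> with swapped coordinates add up to \<open>16 / 3 \<cdot> r ^ 6\<close>, and both have the
  same mean against a radial weight.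
\<close>

lemma integral_gauss_cubic_square_poly:
  "gauss_mean (\<lambda>z. (cubic_harmonic z)\<^sup>2 * poly P ((norm z)\<^sup>2))
    = gauss_mean (\<lambda>z. poly ([:0, 0, 0, 8 / 3:] * P) ((norm z)\<^sup>2))"
proof -
  let ?f = "\<lambda>z. (cubic_harmonic z)\<^sup>2 * poly P ((norm z)\<^sup>2)"
  let ?g = "\<lambda>z. (cubic_harmonic (snd z, fst z))\<^sup>2 * poly P ((norm z)\<^sup>2)"
  have pf: "real_polynomial_function ?f"
    by (intro polynomial_intros)
  have pg: "real_polynomial_function ?g"
    unfolding cubic_harmonic_def fst_conv snd_conv
    by (intro polynomial_intros real_polynomial_function_fst real_polynomial_function_snd)
  have n: "norm (snd z, fst z) = norm z" for z :: "real \<times> real"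
    by (simp add: norm_prod_def add.commute)
  have swap: "gauss_mean ?g = gauss_mean ?f"
    using integral_gauss_swap[OF borel_measurable_polynomial[OF pf]] by (simp add: n)
  have sum: "gauss_mean (\<lambda>z. ?f z + ?g z) = gauss_mean ?f + gauss_mean ?g"
    by (intro Bochner_Integration.integral_add integrable_gauss_polynomial pf pg)
  have eq: "?f z + ?g z = 2 * poly ([:0, 0, 0, 8 / 3:] * P) ((norm z)\<^sup>2)" for z
  proof -
    obtain q p where z: "z = (q, p)" by force
    have "(cubic_harmonic z)\<^sup>2 + (cubic_harmonic (snd z, fst z))\<^sup>2
        = 16 / 3 * ((q ^ 3 - 3 * q * p\<^sup>2)\<^sup>2 + (p ^ 3 - 3 * p * q\<^sup>2)\<^sup>2)"
      unfolding cubic_harmonic_def z fst_conv snd_conv power_mult_distrib power_divide by simp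
    also have "(q ^ 3 - 3 * q * p\<^sup>2)\<^sup>2 + (p ^ 3 - 3 * p * q\<^sup>2)\<^sup>2 = (q\<^sup>2 + p\<^sup>2) ^ 3"
      by algebra
    also have "q\<^sup>2 + p\<^sup>2 = (norm z)\<^sup>2"
      by (simp add: z norm_Pair)
    finally have "(cubic_harmonic z)\<^sup>2 + (cubic_harmonic (snd z, fst z))\<^sup>2 = 16 / 3 * ((norm z)\<^sup>2) ^ 3" .
    moreover have "2 * poly ([:0, 0, 0, 8 / 3:] * P) ((norm z)\<^sup>2) = 16 / 3 * ((norm z)\<^sup>2) ^ 3 * poly P ((norm z)\<^sup>2)"
      by (simp add: power3_eq_cube)
    ultimately show ?thesis
      unfolding distrib_right[symmetric] by (simp only:)
  qed
  from sum show ?thesis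
    unfolding eq swap integral_mult_right_zero by linarith
qed

text \<open>The radial direction of deviation from the vacuum, whose own polynomial is the constant
  1.\<close>

definition F_dev :: "real \<times> real \<Rightarrow> real" where
  "F_dev z = F_poly ((norm z)\<^sup>2) - 1"

lemma F_dev_eq: "F_dev z = poly [:- 2, 6, - 6, 4 / 3:] ((norm z)\<^sup>2)"
  by (simp add: F_dev_def F_poly_def power2_eq_square power3_eq_cube algebra_simps)

lemma real_polynomial_function_F_dev: "real_polynomial_function F_dev"
  unfolding F_dev_def[abs_def] by (intro polynomial_intros)

text \<open>Radial means amount to replacing each power x^n of the squared radius by n!. In the last
  two, the squared harmonic is first traded for 8/3 r^6.\<close>

lemma integral_gauss_F_dev:
  "gauss_mean F_dev = 0"
  "gauss_mean (\<lambda>z. (F_dev z)\<^sup>2) = 244"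
  "gauss_mean (\<lambda>z. (F_dev z) ^ 3) = 173392"
  "gauss_mean (\<lambda>z. (norm z)\<^sup>2) = 1"
  "gauss_mean (\<lambda>z. (norm z)\<^sup>2 * F_dev z) = 6"
  "gauss_mean (\<lambda>z. (cubic_harmonic z)\<^sup>2) = 16"
  "gauss_mean (\<lambda>z. F_dev z * (cubic_harmonic z)\<^sup>2) = 992"
proof -
  let ?P = "[:- 2, 6, - 6, 4 / 3:] :: real poly"
  note e = integral_gauss_poly_norm
  have x: "x = poly [:0, 1:] x" for x :: real
    by simp
  show "gauss_mean F_dev = 0"
    unfolding F_dev_eq[abs_def] e by (simp add: numeral_eq_Suc)
  show "gauss_mean (\<lambda>z. (F_dev z)\<^sup>2) = 244"
    unfolding power2_eq_square[of "F_dev _"]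
    unfolding F_dev_eq poly_mult[symmetric] unfolding e by (simp add: numeral_eq_Suc)
  show "gauss_mean (\<lambda>z. (F_dev z) ^ 3) = 173392"
    unfolding power3_eq_cube[of "F_dev _"]
    unfolding F_dev_eq poly_mult[symmetric] unfolding e by (simp add: numeral_eq_Suc)
  show "gauss_mean (\<lambda>z. (norm z)\<^sup>2) = 1"
    using e[of "[:0, 1:]"] by simp
  have "(norm z)\<^sup>2 * F_dev z = poly ([:0, 1:] * ?P) ((norm z)\<^sup>2)" for z
    by (simp add: F_dev_eq)
  then show "gauss_mean (\<lambda>z. (norm z)\<^sup>2 * F_dev z) = 6"
    by (simp only: e) (simp add: numeral_eq_Suc)
  show "gauss_mean (\<lambda>z. (cubic_harmonic z)\<^sup>2) = 16"
    using integral_gauss_cubic_square_poly[of 1] unfolding e by (simp add: numeral_eq_Suc)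
  show "gauss_mean (\<lambda>z. F_dev z * (cubic_harmonic z)\<^sup>2) = 992"
    using integral_gauss_cubic_square_poly[of ?P]
    unfolding F_dev_eq[symmetric] e by (simp add: numeral_eq_Suc mult.commute)
qed

lemma wigner_poly_dev:
  "wigner_poly t l z = 1 + (t\<^sup>2 / (1 + t\<^sup>2) * F_dev z + l * t / (1 + t\<^sup>2) * cubic_harmonic z)"
proof -
  have "1 + t\<^sup>2 \<noteq> 0"
    using zero_le_power2[of t] by linarith
  moreover have "1 + t\<^sup>2 * F_poly ((norm z)\<^sup>2) + l * t * cubic_harmonic z
      = (1 + t\<^sup>2) + (t\<^sup>2 * F_dev z + l * t * cubic_harmonic z)"
    by (simp add: F_dev_def algebra_simps)
  ultimately show ?thesis
    unfolding wigner_poly_def by (simp only: add_divide_distrib[of "1 + t\<^sup>2"] divide_self)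
      (simp add: add_divide_distrib)
qed

lemmas polynomial_dev_intros = polynomial_intros real_polynomial_function_F_dev

text \<open>\<open>F_dev\<close> is even and the harmonic is odd under z -> -z, so all terms with an
  odd power of the harmonic drop out. The constant 2976 is 3 * 992.\<close>

lemma integral_gauss_deviation:
  fixes a b :: real
  defines "e \<equiv> \<lambda>z. a * F_dev z + b * cubic_harmonic z"
  shows "gauss_mean e = 0"
    and "gauss_mean (\<lambda>z. (norm z)\<^sup>2 * e z) = 6 * a"
    and "gauss_mean (\<lambda>z. (e z)\<^sup>2) = 244 * a\<^sup>2 + 16 * b\<^sup>2"
    and "gauss_mean (\<lambda>z. e z ^ 3) = 173392 * a ^ 3 + 2976 * a * b\<^sup>2"
proof -
  have int: "integrable gauss_measure (\<lambda>z. F_dev z ^ i * cubic_harmonic z ^ j * ((norm z)\<^sup>2) ^ k)" for i j k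
    by (intro integrable_gauss_polynomial polynomial_dev_intros)
  have odd: "gauss_mean (\<lambda>z. F_dev z ^ i * cubic_harmonic z ^ j * ((norm z)\<^sup>2) ^ k) = 0" if "odd j" for i j k
    using that by (intro integral_gauss_odd borel_measurable_polynomial polynomial_dev_intros)
      (simp add: F_dev_def cubic_harmonic_uminus)
  note vals = integral_gauss_F_dev
  show "gauss_mean e = 0"
    unfolding e_def using int[of 1 0 0] int[of 0 1 0] odd[of 1 0 0] vals(1) by simp
  have "(norm z)\<^sup>2 * e z = a * ((norm z)\<^sup>2 * F_dev z) + b * (cubic_harmonic z * (norm z)\<^sup>2)" for z
    by (simp add: e_def algebra_simps)
  then show "gauss_mean (\<lambda>z. (norm z)\<^sup>2 * e z) = 6 * a"
    using int[of 1 0 1] int[of 0 1 1] odd[of 1 0 1] vals(5) by (simp add: mult.commute)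
  have "(e z)\<^sup>2 = a\<^sup>2 * (F_dev z)\<^sup>2 + 2 * a * b * (F_dev z * cubic_harmonic z) + b\<^sup>2 * (cubic_harmonic z)\<^sup>2" for z
    unfolding e_def by algebra
  then show "gauss_mean (\<lambda>z. (e z)\<^sup>2) = 244 * a\<^sup>2 + 16 * b\<^sup>2"
    using int[of 2 0 0] int[of 1 1 0] int[of 0 2 0] odd[of 1 1 0] vals(2,6) by simp
  have "e z ^ 3 = a ^ 3 * F_dev z ^ 3 + 3 * a\<^sup>2 * b * ((F_dev z)\<^sup>2 * cubic_harmonic z)
      + 3 * a * b\<^sup>2 * (F_dev z * (cubic_harmonic z)\<^sup>2) + b ^ 3 * cubic_harmonic z ^ 3" for z
    unfolding e_def by algebra
  then show "gauss_mean (\<lambda>z. e z ^ 3) = 173392 * a ^ 3 + 2976 * a * b\<^sup>2"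
    using int[of 3 0 0] int[of 2 1 0] int[of 1 2 0] int[of 0 3 0] odd[of 1 2 0] odd[of 3 0 0] vals(3,7)
    by simp
qed

section \<open>Entropy\<close>

definition neg_entropy :: "real \<Rightarrow> real \<Rightarrow> real" where
  "neg_entropy t l = gauss_mean (\<lambda>z. wigner_poly t l z * ln (wigner_poly t l z))"

lemma integrable_neg_entropy:
  assumes "0 < t" "t < 1" "\<bar>l\<bar> < lambda_pos t"
  shows "integrable gauss_measure (\<lambda>z. wigner_poly t l z * ln (wigner_poly t l z))"
proof (rule Bochner_Integration.integrable_bound)
  show "integrable gauss_measure (\<lambda>z. (wigner_poly t l z)\<^sup>2 + 1)"
    by (intro integrable_gauss_polynomial polynomial_intros real_polynomial_function_wigner_poly)
  show "AE z in gauss_measure. norm (wigner_poly t l z * ln (wigner_poly t l z)) \<le> norm ((wigner_poly t l z)\<^sup>2 + 1)"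
  proof (rule AE_I2)
    fix z
    have "norm ((wigner_poly t l z)\<^sup>2 + 1) = (wigner_poly t l z)\<^sup>2 + 1"
      by simp
    then show "norm (wigner_poly t l z * ln (wigner_poly t l z)) \<le> norm ((wigner_poly t l z)\<^sup>2 + 1)"
      using abs_xlnx_le[OF wigner_poly_pos[OF assms]] by (simp only: real_norm_def)
  qed
qed simp

text \<open>Split ln W = ln g - ln pi - r^2 with g = \<open>wigner_poly t l\<close>. The mean of g
  is 1, and the mean of r^2 g exceeds the vacuum value 1 by 6 t^2 / (1 + t^2), independently of
  l.\<close>

lemma h_sigma_eq:
  assumes "0 < t" "t < 1" "\<bar>l\<bar> < lambda_pos t"
  shows "h_sigma t l = 1 + ln pi + 6 * t\<^sup>2 / (1 + t\<^sup>2) - neg_entropy t l"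
proof -
  let ?g = "wigner_poly t l"
  have pos: "0 < ?g z" for z
    by (rule wigner_poly_pos[OF assms])
  have log: "wigner (sigma_state t l) z * ln (wigner (sigma_state t l) z)
      = exp (- (norm z)\<^sup>2) / pi * (?g z * ln (?g z) - (ln pi * ?g z + (norm z)\<^sup>2 * ?g z))" for z
    using pos[of z] unfolding wigner_sigma_state
    by (simp add: ln_mult ln_div algebra_simps add_divide_distrib diff_divide_distrib)
  define e where "e = (\<lambda>z. t\<^sup>2 / (1 + t\<^sup>2) * F_dev z + l * t / (1 + t\<^sup>2) * cubic_harmonic z)"
  have g: "?g z = 1 + e z" for z
    unfolding e_def by (rule wigner_poly_dev)
  have pe: "real_polynomial_function e"
    unfolding e_def by (intro polynomial_dev_intros)
  have int: "integrable gauss_measure e" "integrable gauss_measure (\<lambda>z. (norm z)\<^sup>2 * e z)"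
      "integrable gauss_measure (\<lambda>z. (norm z)\<^sup>2)"
    by (intro integrable_gauss_polynomial polynomial_intros pe)+
  have vals: "gauss_mean e = 0" "gauss_mean (\<lambda>z. (norm z)\<^sup>2 * e z) = 6 * (t\<^sup>2 / (1 + t\<^sup>2))"
    unfolding e_def by (rule integral_gauss_deviation)+
  have "gauss_mean (\<lambda>z. ln pi * ?g z + (norm z)\<^sup>2 * ?g z) = ln pi + (1 + 6 * (t\<^sup>2 / (1 + t\<^sup>2)))"
    unfolding g distrib_left using int vals integral_gauss_F_dev(4) gauss.prob_space by simp
  moreover have "integrable gauss_measure (\<lambda>z. ln pi * ?g z + (norm z)\<^sup>2 * ?g z)"
    by (intro integrable_gauss_polynomial polynomial_intros real_polynomial_function_wigner_poly)
  moreover have "h_sigma t l = - gauss_mean (\<lambda>z. ?g z * ln (?g z) - (ln pi * ?g z + (norm z)\<^sup>2 * ?g z))"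
    unfolding h_sigma_def wigner_entropy_def log by (subst integral_gauss) auto
  ultimately show ?thesis
    using integrable_neg_entropy[OF assms] by (simp add: neg_entropy_def)
qed

lemma wigner_poly_affine:
  "wigner_poly t ((1 - u) * x + u * y) z = (1 - u) * wigner_poly t x z + u * wigner_poly t y z"
  by (simp add: wigner_poly_dev algebra_simps add_divide_distrib diff_divide_distrib)

text \<open>\<open>wigner_poly\<close> is affine in l, so pointwise convexity of x ln x passes to
  the mean.\<close>

lemma neg_entropy_convex:
  assumes t: "0 < t" "t < 1"
  shows "convex_on {- lambda_pos t<..<lambda_pos t} (neg_entropy t)"
proof (rule convex_onI)
  fix u x y :: real
  assume u: "0 < u" "u < 1" and I: "x \<in> {- lambda_pos t<..<lambda_pos t}" "y \<in> {- lambda_pos t<..<lambda_pos t}"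
  then have xy: "\<bar>x\<bar> < lambda_pos t" "\<bar>y\<bar> < lambda_pos t"
    by auto
  have "(1 - u) * x + u * y \<in> {- lambda_pos t<..<lambda_pos t}"
    using convexD_alt[OF _ I, of u] u by simp
  then have c: "\<bar>(1 - u) * x + u * y\<bar> < lambda_pos t"
    by auto
  note int = integrable_neg_entropy[OF t]
  have "neg_entropy t ((1 - u) * x + u * y)
      \<le> gauss_mean (\<lambda>z. (1 - u) * (wigner_poly t x z * ln (wigner_poly t x z)) + u * (wigner_poly t y z * ln (wigner_poly t y z)))"
    unfolding neg_entropy_def
  proof (rule integral_mono)
    show "wigner_poly t ((1 - u) * x + u * y) z * ln (wigner_poly t ((1 - u) * x + u * y) z)
      \<le> (1 - u) * (wigner_poly t x z * ln (wigner_poly t x z)) + u * (wigner_poly t y z * ln (wigner_poly t y z))" for z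
      unfolding wigner_poly_affine using wigner_poly_pos[OF t] xy u by (intro xlnx_convex) auto
  qed (use int[OF c] int[OF xy(1)] int[OF xy(2)] in auto)
  also have "\<dots> = (1 - u) * neg_entropy t x + u * neg_entropy t y"
    unfolding neg_entropy_def using int[OF xy(1)] int[OF xy(2)] by simp
  finally show "neg_entropy t ((1 - u) *\<^sub>R x + u *\<^sub>R y) \<le> (1 - u) * neg_entropy t x + u * neg_entropy t y"
    by simp
qed simp

text \<open>Reversing the sign of l reflects phase space at the origin, which preserves
  \<open>gauss_measure\<close>.\<close>

lemma neg_entropy_even:
  "neg_entropy t (- l) = neg_entropy t l"
  unfolding neg_entropy_def wigner_poly_uminus
  by (rule integral_gauss_uminus) measurable

text \<open>\<open>neg_entropy t\<close> is even, so strict convexity between \<open>- y\<close> and \<open>y\<close> makes it strictly increasing.\<close>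

lemma neg_entropy_strict_mono:
  assumes t: "0 < t" "t < 1" and xy: "0 \<le> x" "x < y" "y < lambda_pos t"
  shows "neg_entropy t x < neg_entropy t y"
proof -
  let ?g = "wigner_poly t"
  \<comment> \<open>The weight that places x between -y and y.\<close>
  define u where "u = (x + y) / (2 * y)"
  have u: "0 < u" "u < 1" "(1 - u) * (- y) + u * y = x"
    using xy by (auto simp: u_def field_simps)
  define d where "d = (\<lambda>z. (1 - u) * (?g (- y) z * ln (?g (- y) z)) + u * (?g y z * ln (?g y z)) - ?g x z * ln (?g x z))"
  have g: "?g x z = (1 - u) * ?g (- y) z + u * ?g y z" for z
    using wigner_poly_affine[of t u "- y" y z] unfolding u(3) .
  have pos: "0 < ?g y z" "0 < ?g (- y) z" for z
    using xy by (auto intro!: wigner_poly_pos[OF t])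
  have int: "integrable gauss_measure (\<lambda>z. ?g x z * ln (?g x z))" "integrable gauss_measure (\<lambda>z. ?g y z * ln (?g y z))"
      "integrable gauss_measure (\<lambda>z. ?g (- y) z * ln (?g (- y) z))"
    using xy by (auto intro!: integrable_neg_entropy[OF t])
  have dint: "integrable gauss_measure d"
    unfolding d_def using int by auto
  have nonneg: "0 \<le> d z" for z
    using xlnx_convex[OF pos(2) pos(1) u(1,2)] unfolding d_def g by simp
  \<comment> \<open>Equality in the convexity inequality forces the values at -y and y to coincide,
    hence a vanishing harmonic.\<close>
  have zero: "cubic_harmonic z = 0" if "d z = 0" for z
  proof (rule ccontr)
    assume "cubic_harmonic z \<noteq> 0"
    moreover have "1 + t\<^sup>2 \<noteq> 0"
      using zero_le_power2[of t] by linarith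
    ultimately have "?g (- y) z \<noteq> ?g y z"
      using xy t by (simp add: wigner_poly_dev)
    then show False
      using xlnx_strictly_convex[OF pos(2) pos(1) _ u(1,2)] that unfolding d_def g by fastforce
  qed
  have "gauss_mean d = (1 - u) * neg_entropy t (- y) + u * neg_entropy t y - neg_entropy t x"
    unfolding d_def neg_entropy_def using int by simp
  also have "\<dots> = neg_entropy t y - neg_entropy t x"
    by (simp add: neg_entropy_even algebra_simps)
  finally have md: "gauss_mean d = neg_entropy t y - neg_entropy t x" .
  \<comment> \<open>A zero mean would make the harmonic vanish almost everywhere, although its
    square has mean 16.\<close>
  have "gauss_mean d \<noteq> 0"
  proof
    assume "gauss_mean d = 0"
    then have "AE z in gauss_measure. d z = 0"
      using integral_nonneg_eq_0_iff_AE[OF dint] nonneg by simp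
    then have "AE z in gauss_measure. (cubic_harmonic z)\<^sup>2 = 0"
      by eventually_elim (simp add: zero)
    then have "gauss_mean (\<lambda>z. (cubic_harmonic z)\<^sup>2) = 0"
      by (rule integral_eq_zero_AE)
    then show False
      by (simp add: integral_gauss_F_dev)
  qed
  moreover have "0 \<le> gauss_mean d"
    by (intro Bochner_Integration.integral_nonneg nonneg)
  ultimately show ?thesis
    unfolding md by simp
qed

section \<open>The explicit entropy bound\<close>

lemma neg_entropy_ge:
  assumes t: "0 < t" "t < 1" and l: "\<bar>l\<bar> < lambda_pos t"
  defines "a \<equiv> t\<^sup>2 / (1 + t\<^sup>2)" and "b \<equiv> l * t / (1 + t\<^sup>2)"
  shows "(244 * a\<^sup>2 + 16 * b\<^sup>2) / 2 - (173392 * a ^ 3 + 2976 * a * b\<^sup>2) / 6 \<le> neg_entropy t l"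
proof -
  define e where "e = (\<lambda>z. a * F_dev z + b * cubic_harmonic z)"
  have pe: "real_polynomial_function e"
    unfolding e_def by (intro polynomial_dev_intros)
  have int: "integrable gauss_measure e" "integrable gauss_measure (\<lambda>z. (e z)\<^sup>2)" "integrable gauss_measure (\<lambda>z. e z ^ 3)"
    by (intro integrable_gauss_polynomial polynomial_intros pe)+
  have vals: "gauss_mean e = 0" "gauss_mean (\<lambda>z. (e z)\<^sup>2) = 244 * a\<^sup>2 + 16 * b\<^sup>2"
      "gauss_mean (\<lambda>z. e z ^ 3) = 173392 * a ^ 3 + 2976 * a * b\<^sup>2"
    unfolding e_def by (rule integral_gauss_deviation)+
  have "(244 * a\<^sup>2 + 16 * b\<^sup>2) / 2 - (173392 * a ^ 3 + 2976 * a * b\<^sup>2) / 6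
      = gauss_mean (\<lambda>z. e z + (e z)\<^sup>2 / 2 - e z ^ 3 / 6)"
    using int vals by simp
  also have "\<dots> \<le> neg_entropy t l"
    unfolding neg_entropy_def
  proof (rule integral_mono)
    show "integrable gauss_measure (\<lambda>z. e z + (e z)\<^sup>2 / 2 - e z ^ 3 / 6)"
      using int by auto
    show "e z + (e z)\<^sup>2 / 2 - e z ^ 3 / 6 \<le> wigner_poly t l z * ln (wigner_poly t l z)" for z
    proof -
      have "wigner_poly t l z - 1 = e z"
        unfolding wigner_poly_dev e_def a_def b_def by simp
      then show ?thesis
        using xlnx_ge_cubic[OF wigner_poly_pos[OF t l, of z]] by simp
    qed
  qed (rule integrable_neg_entropy[OF t l])
  finally show ?thesis .
qed

lemma h_sigma_bound:
  assumes t: "0 < t" "t < 1" and l: "\<bar>l\<bar> < lambda_pos t"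
  shows "(h_sigma t l - (1 + ln pi)) / t\<^sup>2
    \<le> (6 - 8 * l\<^sup>2 + (- 110 + 488 * l\<^sup>2) * t\<^sup>2 + 86348 / 3 * t ^ 4) / (1 + t\<^sup>2) ^ 3"
proof -
  define s where "s = 1 + t\<^sup>2"
  have s: "0 < s"
    using zero_le_power2[of t] unfolding s_def by linarith
  have "h_sigma t l - (1 + ln pi) \<le> 6 * t\<^sup>2 / s
      - ((244 * (t\<^sup>2 / s)\<^sup>2 + 16 * (l * t / s)\<^sup>2) / 2 - (173392 * (t\<^sup>2 / s) ^ 3 + 2976 * (t\<^sup>2 / s) * (l * t / s)\<^sup>2) / 6)"
    using neg_entropy_ge[OF t l] h_sigma_eq[OF t l] unfolding s_def by linarith
  also have "\<dots> = t\<^sup>2 * ((6 * s\<^sup>2 - (122 * t\<^sup>2 + 8 * l\<^sup>2) * s + (86696 / 3 * t ^ 4 + 496 * t\<^sup>2 * l\<^sup>2)) / s ^ 3)"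
    using s by (simp add: field_simps power2_eq_square power3_eq_cube power4_eq_xxxx)
  \<comment> \<open>The stated constants arise by expanding s = 1 + t^2: -110 = 12 - 122, 488 = 496
    - 8 and 86348/3 = 86696/3 + 6 - 122.\<close>
  also have "6 * s\<^sup>2 - (122 * t\<^sup>2 + 8 * l\<^sup>2) * s + (86696 / 3 * t ^ 4 + 496 * t\<^sup>2 * l\<^sup>2)
      = 6 - 8 * l\<^sup>2 + (- 110 + 488 * l\<^sup>2) * t\<^sup>2 + 86348 / 3 * t ^ 4"
    unfolding s_def by algebra
  finally have "h_sigma t l - (1 + ln pi) \<le> t\<^sup>2 * ((6 - 8 * l\<^sup>2 + (- 110 + 488 * l\<^sup>2) * t\<^sup>2 + 86348 / 3 * t ^ 4) / s ^ 3)" .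
  then show ?thesis
    using t unfolding s_def by (simp add: divide_le_eq mult.commute)
qed

section \<open>Monotonicity, continuity and the unique zero\<close>

lemma h_sigma_strict_antimono:
  assumes t: "0 < t" "t < 1"
  shows "strict_antimono_on {0..<lambda_pos t} (h_sigma t)"
  using neg_entropy_strict_mono[OF t] h_sigma_eq[OF t] by (auto simp: monotone_on_def)

text \<open>A convex function is continuous on an open interval; taking the symmetric interval makes
  l = 0 an interior point.\<close>

lemma h_sigma_continuous_on:
  assumes t: "0 < t" "t < 1"
  shows "continuous_on {- lambda_pos t<..<lambda_pos t} (h_sigma t)"
proof -
  have "continuous_on {- lambda_pos t<..<lambda_pos t} (neg_entropy t)"
    by (intro convex_on_continuous neg_entropy_convex[OF t]) auto
  then have "continuous_on {- lambda_pos t<..<lambda_pos t} (\<lambda>l. 1 + ln pi + 6 * t\<^sup>2 / (1 + t\<^sup>2) - neg_entropy t l)"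
    by (intro continuous_intros)
  then show ?thesis
    by (rule continuous_on_eq) (auto simp: h_sigma_eq[OF t])
qed

lemma h_sigma_unique_zero:
  assumes t: "0 < t" "t < 1"
    and a: "a \<in> {0..<lambda_pos t}" "h_sigma t a - c > 0" and b: "b \<in> {0..<lambda_pos t}" "h_sigma t b - c < 0"
  shows "\<exists>!l. l \<in> {0..<lambda_pos t} \<and> h_sigma t l - c = 0"
proof -
  have anti: "h_sigma t y < h_sigma t x" if "x \<in> {0..<lambda_pos t}" "y \<in> {0..<lambda_pos t}" "x < y" for x y
    using monotone_onD[OF h_sigma_strict_antimono[OF t]] that by blast
  \<comment> \<open>The entropy decreases, so the positive sign occurs to the left of the negative
    one.\<close>
  have "a \<le> b"
    using anti[of b a] a b by (cases "a \<le> b") auto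
  moreover have "continuous_on {a..b} (h_sigma t)"
    using a b by (intro continuous_on_subset[OF h_sigma_continuous_on[OF t]]) auto
  ultimately obtain l where l: "a \<le> l" "l \<le> b" "h_sigma t l = c"
    using IVT2'[of "h_sigma t" b c a] a b by auto
  then have l': "l \<in> {0..<lambda_pos t}"
    using a b by auto
  moreover have "m = l" if "m \<in> {0..<lambda_pos t}" "h_sigma t m = c" for m
    using anti[of m l] anti[of l m] l l' that by (cases m l rule: linorder_cases) auto
  ultimately show ?thesis
    using l(3) by (metis diff_self eq_iff_diff_eq_0)
qed

section \<open>The sufficient condition\<close>

lemma numerator_neg_iff:
  fixes t l :: real
  assumes D: "8 - 488 * t\<^sup>2 > 0" and l: "0 \<le> l"
  shows "6 - 8 * l\<^sup>2 + (- 110 + 488 * l\<^sup>2) * t\<^sup>2 + 86348 / 3 * t ^ 4 < 0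
    \<longleftrightarrow> sqrt ((6 - 110 * t\<^sup>2 + 86348 / 3 * t ^ 4) / (8 - 488 * t\<^sup>2)) < l"
proof -
  have "6 - 8 * l\<^sup>2 + (- 110 + 488 * l\<^sup>2) * t\<^sup>2 + 86348 / 3 * t ^ 4 < 0
    \<longleftrightarrow> 6 - 110 * t\<^sup>2 + 86348 / 3 * t ^ 4 < l\<^sup>2 * (8 - 488 * t\<^sup>2)"
    by (simp add: algebra_simps)
  also have "\<dots> \<longleftrightarrow> (6 - 110 * t\<^sup>2 + 86348 / 3 * t ^ 4) / (8 - 488 * t\<^sup>2) < l\<^sup>2"
    using D by (simp add: divide_less_eq)
  also have "\<dots> \<longleftrightarrow> sqrt ((6 - 110 * t\<^sup>2 + 86348 / 3 * t ^ 4) / (8 - 488 * t\<^sup>2)) < l"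
    using l real_sqrt_less_iff[of _ "l\<^sup>2"] by simp
  finally show ?thesis .
qed

text \<open>Completing the square in t^2 shows that the radicand is nonnegative. This matters
  because \<open>sqrt\<close> of a negative number is negative; it makes every l above the threshold
  nonnegative.\<close>

lemma threshold_nonneg:
  fixes t :: real
  assumes "8 - 488 * t\<^sup>2 > 0"
  shows "0 \<le> sqrt ((6 - 110 * t\<^sup>2 + 86348 / 3 * t ^ 4) / (8 - 488 * t\<^sup>2))"
proof -
  have "0 \<le> 6 * (1 - 55 / 6 * t\<^sup>2)\<^sup>2 + (86348 / 3 - 3025 / 6) * t ^ 4"
    by simp
  also have "\<dots> = 6 - 110 * t\<^sup>2 + 86348 / 3 * t ^ 4"
    by algebra
  finally show ?thesis
    using assms by simp
qed

theorem mainTheorem5: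
  fixes t :: real
  assumes "0 < t" and "t < 1"
  shows
    "((\<exists>x. 0 < x \<and> t\<^sup>2 * (4 * x ^ 3 - 6 * x\<^sup>2 - 6 * x + 3) = 3
           \<and> (\<forall>y. 0 < y \<and> t\<^sup>2 * (4 * y ^ 3 - 6 * y\<^sup>2 - 6 * y + 3) = 3 \<longrightarrow> y = x)
           \<and> is_arg_min (pos_bound t) (\<lambda>y. 0 < y) x
           \<and> lambda_pos t = pos_bound t x)
      \<and> (\<forall>l. 0 \<le> l \<and> l < 1 \<longrightarrow> ((\<forall>z. 0 \<le> wigner (sigma_state t l) z) \<longleftrightarrow> l \<le> lambda_pos t)))
     \<and>
     (strict_antimono_on {0..<lambda_pos t} (h_sigma t)
      \<and> ((\<exists>l\<in>{0..<lambda_pos t}. h_sigma t l - (1 + ln pi) > 0)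
           \<and> (\<exists>l\<in>{0..<lambda_pos t}. h_sigma t l - (1 + ln pi) < 0)
         \<longrightarrow> (\<exists>!l. l \<in> {0..<lambda_pos t} \<and> h_sigma t l - (1 + ln pi) = 0)))
     \<and>
     (\<forall>l\<in>{0..<lambda_pos t}.
        (h_sigma t l - (1 + ln pi)) / t\<^sup>2
          \<le> (6 - 8 * l\<^sup>2 + (- 110 + 488 * l\<^sup>2) * t\<^sup>2 + 86348 / 3 * t ^ 4) / (1 + t\<^sup>2) ^ 3)
     \<and>
     (\<forall>T :: real set.
        (\<forall>s\<in>T. 0 < s \<and> s < 1 \<and> 8 - 488 * s\<^sup>2 > 0) \<and> 0.005 \<in> T \<and> t \<in> T \<longrightarrow>
        (\<forall>l\<in>{0..<lambda_pos t}.
           6 - 8 * l\<^sup>2 + (- 110 + 488 * l\<^sup>2) * t\<^sup>2 + 86348 / 3 * t ^ 4 < 0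
           \<longleftrightarrow> sqrt ((6 - 110 * t\<^sup>2 + 86348 / 3 * t ^ 4) / (8 - 488 * t\<^sup>2)) < l)
        \<and> (\<forall>l. sqrt ((6 - 110 * t\<^sup>2 + 86348 / 3 * t ^ 4) / (8 - 488 * t\<^sup>2)) < l
               \<and> l < lambda_pos t \<longrightarrow> h_sigma t l < 1 + ln pi))"
proof (intro conjI allI impI ballI)
  note t = assms
  obtain x where x: "0 < x" "crit_poly t x = 0" "\<And>y. 0 < y \<Longrightarrow> crit_poly t y = 0 \<Longrightarrow> y = x"
    "\<And>y. 0 < y \<Longrightarrow> pos_bound t x \<le> pos_bound t y"
    using pos_bound_min[OF t] by metis
  show "\<exists>x. 0 < x \<and> t\<^sup>2 * (4 * x ^ 3 - 6 * x\<^sup>2 - 6 * x + 3) = 3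
           \<and> (\<forall>y. 0 < y \<and> t\<^sup>2 * (4 * y ^ 3 - 6 * y\<^sup>2 - 6 * y + 3) = 3 \<longrightarrow> y = x)
           \<and> is_arg_min (pos_bound t) (\<lambda>y. 0 < y) x
           \<and> lambda_pos t = pos_bound t x"
  proof (intro exI[of _ x] conjI allI impI)
    show "t\<^sup>2 * (4 * x ^ 3 - 6 * x\<^sup>2 - 6 * x + 3) = 3"
      using x(2) unfolding crit_poly_def by linarith
    show "y = x" if "0 < y \<and> t\<^sup>2 * (4 * y ^ 3 - 6 * y\<^sup>2 - 6 * y + 3) = 3" for y
      using x(3)[of y] that unfolding crit_poly_def by linarith
    show "is_arg_min (pos_bound t) (\<lambda>y. 0 < y) x"
      using x(1,4) unfolding is_arg_min_def by (meson not_less)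
    show "lambda_pos t = pos_bound t x"
      by (rule lambda_pos_eqI[OF x(1,4)])
  qed (rule x)
next
  fix l :: real
  assume "0 \<le> l \<and> l < 1"
  then show "(\<forall>z. 0 \<le> wigner (sigma_state t l) z) \<longleftrightarrow> l \<le> lambda_pos t"
    unfolding wigner_nonneg_iff using wigner_poly_nonneg_iff[OF assms] by blast
next
  show "strict_antimono_on {0..<lambda_pos t} (h_sigma t)"
    by (rule h_sigma_strict_antimono[OF assms])
next
  assume "(\<exists>l\<in>{0..<lambda_pos t}. h_sigma t l - (1 + ln pi) > 0)
           \<and> (\<exists>l\<in>{0..<lambda_pos t}. h_sigma t l - (1 + ln pi) < 0)"
  then show "\<exists>!l. l \<in> {0..<lambda_pos t} \<and> h_sigma t l - (1 + ln pi) = 0"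
    using h_sigma_unique_zero[OF assms] by blast
next
  fix l assume "l \<in> {0..<lambda_pos t}"
  then show "(h_sigma t l - (1 + ln pi)) / t\<^sup>2
      \<le> (6 - 8 * l\<^sup>2 + (- 110 + 488 * l\<^sup>2) * t\<^sup>2 + 86348 / 3 * t ^ 4) / (1 + t\<^sup>2) ^ 3"
    by (intro h_sigma_bound[OF assms]) auto
next
  fix T :: "real set" and l
  assume "(\<forall>s\<in>T. 0 < s \<and> s < 1 \<and> 8 - 488 * s\<^sup>2 > 0) \<and> 0.005 \<in> T \<and> t \<in> T"
    and "l \<in> {0..<lambda_pos t}"
  then show "6 - 8 * l\<^sup>2 + (- 110 + 488 * l\<^sup>2) * t\<^sup>2 + 86348 / 3 * t ^ 4 < 0
      \<longleftrightarrow> sqrt ((6 - 110 * t\<^sup>2 + 86348 / 3 * t ^ 4) / (8 - 488 * t\<^sup>2)) < l"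
    by (intro numerator_neg_iff) auto
next
  fix T :: "real set" and l
  assume T: "(\<forall>s\<in>T. 0 < s \<and> s < 1 \<and> 8 - 488 * s\<^sup>2 > 0) \<and> 0.005 \<in> T \<and> t \<in> T"
    and l: "sqrt ((6 - 110 * t\<^sup>2 + 86348 / 3 * t ^ 4) / (8 - 488 * t\<^sup>2)) < l \<and> l < lambda_pos t"
  from T have D: "8 - 488 * t\<^sup>2 > 0"
    by blast
  have l0: "0 \<le> l"
    using threshold_nonneg[OF D] l by linarith
  have "0 < (1 + t\<^sup>2) ^ 3"
    by (intro zero_less_power add_pos_nonneg) auto
  then have "(6 - 8 * l\<^sup>2 + (- 110 + 488 * l\<^sup>2) * t\<^sup>2 + 86348 / 3 * t ^ 4) / (1 + t\<^sup>2) ^ 3 < 0"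
    using numerator_neg_iff[OF D l0] l by (intro divide_neg_pos) auto
  then have "(h_sigma t l - (1 + ln pi)) / t\<^sup>2 < 0"
    using h_sigma_bound[OF assms, of l] l l0 by simp
  then show "h_sigma t l < 1 + ln pi"
    using assms by (simp add: divide_less_0_iff)
qed

end
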